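(* $\mathcal{C}_{\mathsf{B}_{4,4}}\le 26$.
   Context: Let $\mathsf{B}_{4,4}=\{x^\alpha:\alpha\in\mathbb{N}_0^4,\ |\alpha|=4\}$ be the set of monomials of degree $4$ in four variables. Functions are considered on the real projective space $\mathbb{P}(\mathbb{R}^3)$, realized as the set of points of the unit sphere in $\mathbb{R}^4$ whose first non-vanishing coordinate is positive. A real vector $s=(s_\alpha)_{|\alpha|=4}$ is a moment sequence of $\mathsf{B}_{4,4}$ if there is a positive Radon measure $\mu$ on $\mathbb{P}(\mathbb{R}^3)$ with $s_\alpha=\int x^\alpha\,d\mu$ for all $\alpha$; such $\mu$ is a representing measure of $s$. A $k$-atomic measure is $\sum_{i=1}^k c_i\delta_{x_i}$ with pairwise different points $x_i$ and all $c_i>0$ (the zero measure is $0$-atomic). The Carathéodory number $\mathcal{C}_{\mathsf{B}_{4,4}}$ is the smallest number such that every moment sequence of $\mathsf{B}_{4,4}$ has a $k$-atomic representing measure with $k\le\mathcal{C}_{\mathsf{B}_{4,4}}$. *)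

theory Defs
  imports "HOL-Analysis.Analysis" "HOL-Library.Extended_Nat" "HOL-Library.Numeral_Type"
begin

definition proj_points :: "(real ^ 'n::{finite,linorder}) set" where
  "proj_points = {x \<in> sphere 0 1. \<exists>i. x $ i > 0 \<and> (\<forall>j<i. x $ j = 0)}"

definition proj_rep :: "real ^ 'n::{finite,linorder} \<Rightarrow> real ^ 'n::{finite,linorder}" where
  "proj_rep x = (if x \<in> proj_points then x else - x)"

text \<open>
  The topology is the quotient topology of the sphere modulo \<open>x \<sim> - x\<close> (which is compact),
  not the subspace topology that \<open>proj_points\<close> inherits from the ambient space.
\<close>

definition projective_space :: "(real ^ 'n::{finite,linorder}) topology" where
  "projective_space = topology (\<lambda>U. U \<subseteq> proj_points \<and>
     openin (top_of_set (sphere 0 1)) {x \<in> sphere 0 1. proj_rep x \<in> U})"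

lemma openin_projective_space:
  fixes U :: "(real ^ 'n::{finite,linorder}) set"
  shows "openin projective_space U \<longleftrightarrow> U \<subseteq> proj_points \<and>
     openin (top_of_set (sphere 0 1)) {x \<in> sphere 0 1. proj_rep x \<in> U}"
proof -
  have "istopology (\<lambda>U :: (real ^ 'n::{finite,linorder}) set. U \<subseteq> proj_points \<and>
      openin (top_of_set (sphere 0 1)) {x \<in> sphere 0 1. proj_rep x \<in> U})"
    unfolding istopology_def
  proof (intro conjI allI impI)
    fix S T :: "(real ^ 'n::{finite,linorder}) set"
    assume S: "S \<subseteq> proj_points \<and>
        openin (top_of_set (sphere 0 1)) {x \<in> sphere 0 1. proj_rep x \<in> S}"
      and T: "T \<subseteq> proj_points \<and>
        openin (top_of_set (sphere 0 1)) {x \<in> sphere 0 1. proj_rep x \<in> T}"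
    show "S \<inter> T \<subseteq> proj_points"
      using S by blast
    have "{x \<in> sphere 0 1. proj_rep x \<in> S \<inter> T} =
        {x \<in> sphere 0 1. proj_rep x \<in> S} \<inter> {x \<in> sphere 0 1. proj_rep x \<in> T}"
      by blast
    then show "openin (top_of_set (sphere 0 1)) {x \<in> sphere 0 1. proj_rep x \<in> S \<inter> T}"
      using openin_Int[OF conjunct2[OF S] conjunct2[OF T]] by simp
  next
    fix \<K> :: "(real ^ 'n::{finite,linorder}) set set"
    assume \<K>: "\<forall>K\<in>\<K>. K \<subseteq> proj_points \<and>
        openin (top_of_set (sphere 0 1)) {x \<in> sphere 0 1. proj_rep x \<in> K}"
    then show "\<Union>\<K> \<subseteq> proj_points"
      by blast
    have "{x \<in> sphere 0 1. proj_rep x \<in> \<Union>\<K>} =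
        \<Union>((\<lambda>K. {x \<in> sphere 0 1. proj_rep x \<in> K}) ` \<K>)"
      by blast
    moreover have "openin (top_of_set (sphere 0 1))
        (\<Union>((\<lambda>K. {x \<in> sphere 0 1. proj_rep x \<in> K}) ` \<K>))"
      using \<K> by (intro openin_Union) blast
    ultimately show "openin (top_of_set (sphere 0 1)) {x \<in> sphere 0 1. proj_rep x \<in> \<Union>\<K>}"
      by simp
  qed
  then show ?thesis
    unfolding projective_space_def by (subst topology_inverse') simp_all
qed

lemma proj_rep_in:
  fixes x :: "real ^ 'n::{finite,linorder}"
  assumes "x \<in> sphere 0 1"
  shows "proj_rep x \<in> proj_points"
proof (cases "x \<in> proj_points")
  case False
  from assms have "x \<noteq> 0"
    by auto
  then have ne: "{i. x $ i \<noteq> 0} \<noteq> {}"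
    by (auto simp: vec_eq_iff)
  define i where "i = Min {i. x $ i \<noteq> 0}"
  have i: "x $ i \<noteq> 0"
    using Min_in[OF _ ne] unfolding i_def by simp
  have j: "x $ j = 0" if "j < i" for j
    using that Min_le[of "{i. x $ i \<noteq> 0}" j] unfolding i_def by fastforce
  have "x $ i < 0"
    using False assms i j unfolding proj_points_def by force
  then have "- x \<in> proj_points"
    using assms j unfolding proj_points_def by auto
  then show ?thesis
    using False by (simp add: proj_rep_def)
qed (simp add: proj_rep_def)

lemma topspace_projective_space [simp]:
  "topspace projective_space = (proj_points :: (real ^ 'n::{finite,linorder}) set)"
proof
  show "topspace projective_space \<subseteq> (proj_points :: (real ^ 'n::{finite,linorder}) set)"
    using openin_topspace[of projective_space] unfolding openin_projective_space by (rule conjunct1)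
  have "{x \<in> sphere 0 1. proj_rep x \<in> proj_points} = (sphere 0 1 :: (real ^ 'n::{finite,linorder}) set)"
    using proj_rep_in by blast
  then have "openin projective_space (proj_points :: (real ^ 'n::{finite,linorder}) set)"
    unfolding openin_projective_space by (simp only: openin_subtopology_self subset_refl simp_thms)
  then show "(proj_points :: (real ^ 'n::{finite,linorder}) set) \<subseteq> topspace projective_space"
    by (rule openin_subset)
qed

lemma quotient_map_proj_rep:
  "quotient_map (top_of_set (sphere 0 1)) projective_space
     (proj_rep :: real ^ 'n::{finite,linorder} \<Rightarrow> real ^ 'n::{finite,linorder})"
proof -
  have "proj_rep ` sphere 0 1 = (proj_points :: (real ^ 'n::{finite,linorder}) set)"
  proof
    show "(proj_points :: (real ^ 'n::{finite,linorder}) set) \<subseteq> proj_rep ` sphere 0 1"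
    proof
      fix x :: "real ^ 'n::{finite,linorder}"
      assume x: "x \<in> proj_points"
      then have "x = proj_rep x" "x \<in> sphere 0 1"
        by (simp_all add: proj_rep_def proj_points_def)
      then show "x \<in> proj_rep ` sphere 0 1"
        by (rule image_eqI)
    qed
  qed (use proj_rep_in in blast)
  then show ?thesis
    unfolding quotient_map_def openin_projective_space
    by (simp only: topspace_euclidean_subtopology topspace_projective_space) blast
qed

definition radon_measure_on :: "'a topology \<Rightarrow> 'a measure \<Rightarrow> bool" where
  "radon_measure_on X M \<longleftrightarrow>
     sets M = sets (sigma (topspace X) {U. openin X U}) \<and>
     (\<forall>K. compactin X K \<longrightarrow> emeasure M K < \<infinity>) \<and>
     (\<forall>A\<in>sets M. emeasure M A = (SUP K\<in>{K. compactin X K \<and> K \<subseteq> A}. emeasure M K))"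

text \<open>
  A finite system of functions is given as a family \<open>f\<close> indexed by a set \<open>I\<close>;
  only the entries \<open>s i\<close> with \<open>i \<in> I\<close> of a sequence are relevant.
\<close>

definition representing_measure ::
    "'a topology \<Rightarrow> 'i set \<Rightarrow> ('i \<Rightarrow> 'a \<Rightarrow> real) \<Rightarrow> ('i \<Rightarrow> real) \<Rightarrow> 'a measure \<Rightarrow> bool" where
  "representing_measure X I f s M \<longleftrightarrow>
     radon_measure_on X M \<and> (\<forall>i\<in>I. has_bochner_integral M (f i) (s i))"

definition moment_sequence ::
    "'a topology \<Rightarrow> 'i set \<Rightarrow> ('i \<Rightarrow> 'a \<Rightarrow> real) \<Rightarrow> ('i \<Rightarrow> real) \<Rightarrow> bool" where
  "moment_sequence X I f s \<longleftrightarrow> (\<exists>M. representing_measure X I f s M)"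

definition atomic_measure :: "'a topology \<Rightarrow> nat \<Rightarrow> 'a measure \<Rightarrow> bool" where
  "atomic_measure X k M \<longleftrightarrow>
     sets M = sets (sigma (topspace X) {U. openin X U}) \<and>
     (\<exists>P c. finite P \<and> card P = k \<and> P \<subseteq> topspace X \<and> (\<forall>p\<in>P. (c p :: real) > 0) \<and>
        (\<forall>A\<in>sets M. emeasure M A = (\<Sum>p\<in>P. ennreal (c p) * indicator A p)))"

text \<open>
  The infimum is taken in \<^typ>\<open>enat\<close>, so the value is \<open>\<infinity>\<close> if no bound exists.
\<close>

definition caratheodory_number ::
    "'a topology \<Rightarrow> 'i set \<Rightarrow> ('i \<Rightarrow> 'a \<Rightarrow> real) \<Rightarrow> enat" where
  "caratheodory_number X I f = Inf {enat N |N.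
     \<forall>s. moment_sequence X I f s \<longrightarrow>
       (\<exists>k\<le>N. \<exists>M. atomic_measure X k M \<and> representing_measure X I f s M)}"

definition exponents_of_degree :: "nat \<Rightarrow> (nat ^ 'n) set" where
  "exponents_of_degree d = {\<alpha>. (\<Sum>i\<in>UNIV. \<alpha> $ i) = d}"

definition monomial :: "nat ^ 'n \<Rightarrow> real ^ 'n \<Rightarrow> real" where
  "monomial \<alpha> x = (\<Prod>i\<in>UNIV. (x $ i) ^ (\<alpha> $ i))"

end

theory Submission
  imports Defs "HOL-Computational_Algebra.Polynomial"
begin

text \<open>
  Write \<open>v(x)\<close> for the vector of the 35 quartic monomials at \<open>x\<close>. Integration against a measure is
  linear, so by separation a moment vector \<open>s\<close> lies in the closed convex cone \<open>C\<close> generated by the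
  values of \<open>v\<close> on the unit sphere. Subtract from \<open>s\<close> the largest possible multiple of one \<open>v(x\<^sub>0)\<close>.
  What remains is in \<open>C\<close> but not in its relative interior, so some quartic form \<open>p \<ge> 0\<close>, \<open>p \<noteq> 0\<close>,
  pairs to zero with it, and it is a positive combination of vectors \<open>v(z)\<close> with \<open>p(z) = 0\<close>. By
  Caratheodory's theorem the number of these can be taken to be at most the dimension of their span.
  Hence it suffices that for every nonnegative quartic form \<open>p \<noteq> 0\<close> with zero set \<open>Z\<close> the vectors
  \<open>v(z)\<close>, \<open>z \<in> Z\<close>, span at most 25 dimensions (\<open>dim_veronese_zeros_le\<close>); then \<open>25 + 1 = 26\<close> atoms are
  enough (\<open>conic_hull_atoms\<close>). Equivalently, at least 10 linearly independent quartic forms must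
  vanish on \<open>Z\<close>.

  If \<open>Z\<close> lies on a quadric \<open>b = 0\<close> with \<open>b \<noteq> 0\<close>, the products of \<open>b\<close> with the ten quadratic
  monomials do this. Otherwise the derivatives of \<open>p\<close> are used: every zero is a minimum, so the
  gradient vanishes on \<open>Z\<close>, and with it the quartics \<open>\<nabla>p(x) \<cdot> Ax\<close> for all \<open>4 \<times> 4\<close> matrices \<open>A\<close>.
  There are 16 parameters, so it remains to see that the matrices whose quartic is identically zero,
  which form the Lie algebra of the stabilizer of \<open>p\<close> in the general linear group, span at most
  6 dimensions (\<open>dim_annihilator_le\<close>).

  Two facts control this Lie algebra. Differentiating \<open>\<nabla>p(x) \<cdot> Ax = 0\<close> at a zero \<open>z\<close> shows that
  \<open>Az\<close> lies in the kernel of the Hessian at \<open>z\<close>. And if \<open>Z\<close> is on no quadric, this kernel has dimension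
  at most 2, unless \<open>p\<close> is constant along \<open>z\<close>: a Hessian of rank one has the form
  \<open>\<lambda>\<^sup>2\<close> for a linear form \<open>\<lambda>\<close>, and then nonnegativity of \<open>p\<close> on all lines in direction \<open>z\<close> forces the
  cubic coefficient to be \<open>\<lambda>\<close> times a nonzero quadratic form that vanishes on \<open>Z\<close>
  (\<open>on_quadric_if_rank_one\<close>). Now \<open>Z\<close> spans the whole space, as hyperplanes lie in quadrics. Take a basis
  of zeros. If the Lie algebra had dimension 7, six linear conditions would leave a nonzero matrix
  in it that kills three of the basis vectors. Such a matrix has rank one, and its image consists of
  directions along which \<open>p\<close> is constant (\<open>annihilator_rank_one\<close>); the six conditions are chosen so as
  to exclude this.
\<close>

section \<open>Nonnegative quartic forms and their zeros\<close>

text \<open>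
  All positivity arguments below restrict a form to the lines through a point and come down to this:
  an odd leading term is impossible, and a nonnegative quadratic polynomial has no positive
  discriminant.
\<close>

lemma nonneg_cubic_coefficients:
  fixes a b c d :: real
  assumes nn: "\<And>s. 0 \<le> a * s ^ 3 + b * s ^ 2 + c * s + d"
  shows "a = 0" "0 \<le> b" "c ^ 2 \<le> 4 * b * d"
proof -
  show a: "a = 0"
  proof (rule ccontr)
    assume "a \<noteq> 0"
    define K where "K = \<bar>b\<bar> + \<bar>c\<bar> + \<bar>d\<bar>"
    \<comment> \<open>At \<open>s = \<plusminus>N\<close> with the sign opposite to that of \<open>a\<close>, the cubic term outweighs the
      others, each of which is at most a coefficient times \<open>N\<^sup>2\<close>.\<close>
    define N where "N = K / \<bar>a\<bar> + 1"
    have N: "1 \<le> N" "\<bar>a\<bar> * N = K + \<bar>a\<bar>"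
      using \<open>a \<noteq> 0\<close> by (simp_all add: N_def K_def field_simps)
    have "0 \<le> a * (- sgn a * N) ^ 3 + b * (- sgn a * N) ^ 2 + c * (- sgn a * N) + d"
      by (rule nn)
    also have "\<dots> = - \<bar>a\<bar> * N ^ 3 + b * N ^ 2 + c * (- sgn a * N) + d"
      using \<open>a \<noteq> 0\<close> by (auto simp: sgn_if power_mult_distrib)
    also have "\<dots> \<le> - \<bar>a\<bar> * N ^ 3 + \<bar>b\<bar> * N ^ 2 + \<bar>c\<bar> * N ^ 2 + \<bar>d\<bar> * N ^ 2"
    proof -
      have "N \<le> N ^ 2" "1 \<le> N ^ 2"
        using N(1) by (simp_all add: self_le_power one_le_power)
      then have "\<bar>c\<bar> * N \<le> \<bar>c\<bar> * N ^ 2" "\<bar>d\<bar> * 1 \<le> \<bar>d\<bar> * N ^ 2"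
        by (intro mult_left_mono; simp)+
      moreover have "b * N ^ 2 \<le> \<bar>b\<bar> * N ^ 2"
        by (intro mult_right_mono) auto
      moreover have "c * (- sgn a * N) \<le> \<bar>c\<bar> * N"
        using N(1) by (auto simp: sgn_if intro: mult_right_mono) (metis abs_ge_minus_self minus_mult_left mult_right_mono order_trans zero_le_one)
      ultimately show ?thesis by linarith
    qed
    also have "\<dots> = (K - \<bar>a\<bar> * N) * N ^ 2"
      by (simp add: K_def algebra_simps power3_eq_cube power2_eq_square)
    also have "\<dots> < 0"
      using N \<open>a \<noteq> 0\<close> by (simp add: mult_less_0_iff)
    finally show False by simp
  qed
  show b: "0 \<le> b"
  proof (rule ccontr)
    assume "\<not> 0 \<le> b"
    define N where "N = \<bar>d\<bar> / - b + 1"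
    have N: "1 \<le> N" "b * N = - \<bar>d\<bar> + b"
      using \<open>\<not> 0 \<le> b\<close> by (simp_all add: N_def field_simps)
    have "0 \<le> b * N ^ 2 + c * N + d" "0 \<le> b * N ^ 2 - c * N + d"
      using nn[of N] nn[of "- N"] a by simp_all
    moreover have "b * N ^ 2 \<le> b * N"
      using N(1) \<open>\<not> 0 \<le> b\<close> by (intro mult_left_mono_neg) (auto simp: self_le_power)
    ultimately show False
      using N(2) \<open>\<not> 0 \<le> b\<close> by linarith
  qed
  show "c ^ 2 \<le> 4 * b * d"
  proof (cases "b = 0")
    case True
    have "c = 0"
    proof (rule ccontr)
      assume "c \<noteq> 0"
      then show False
        using nn[of "- (d + 1) / c"] a True by simp
    qed
    then show ?thesis using True by simp
  next
    case False
    with b have "b > 0" by simp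
    then show ?thesis
      using nn[of "- c / (2 * b)"] a by (simp add: field_simps power2_eq_square)
  qed
qed

text \<open>
  The quadratic form is given by a bilinear form \<open>\<beta>\<close>, where only the diagonal \<open>\<beta> x x\<close> matters:
  it has to be nonzero somewhere, since an alternating \<open>\<beta>\<close> gives the zero form.
\<close>

definition on_quadric :: "'a::real_vector set \<Rightarrow> bool" where
  "on_quadric Z \<longleftrightarrow> (\<exists>\<beta> :: 'a \<Rightarrow> 'a \<Rightarrow> real. bilinear \<beta> \<and> (\<exists>x. \<beta> x x \<noteq> 0) \<and> (\<forall>z\<in>Z. \<beta> z z = 0))"

text \<open>
  A quartic form \<open>p(x) = P x x x x\<close> is handled through its polarization \<open>P\<close>, which turns derivatives into
  algebra: the gradient at \<open>x\<close> is \<open>4 P x x x\<close> and the Hessian at \<open>x\<close> is \<open>12 P x x\<close>.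
\<close>

locale nonneg_quartic =
  fixes P :: "'a::euclidean_space \<Rightarrow> 'a \<Rightarrow> 'a \<Rightarrow> 'a \<Rightarrow> real"
  assumes linear_last: "linear (P a b c)"
    and swap12: "P a b c d = P b a c d"
    and swap23: "P a b c d = P a c b d"
    and swap34: "P a b c d = P a b d c"
    and nonneg: "0 \<le> P x x x x"
begin

definition zeros :: "'a set" where "zeros = {z. P z z z z = 0}"

definition hessian_kernel :: "'a \<Rightarrow> 'a set" where
  "hessian_kernel z = {w. \<forall>v. P z z v w = 0}"

text \<open>
  The directions along which the form is constant, that is, the vertex of the cone \<open>p = 0\<close>; it is zero
  if and only if no linear change of coordinates makes \<open>p\<close> depend on fewer variables.
\<close>

definition vertex :: "'a set" where "vertex = {a. \<forall>x. P x x x a = 0}"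

lemma linear3: "linear (\<lambda>c. P a b c d)"
  using linear_last[of a b d] by (simp add: swap34[of a b _ d])
lemma linear2: "linear (\<lambda>b. P a b c d)"
  using linear3[of a c d] by (simp add: swap23[of a _ c d])
lemma linear1: "linear (\<lambda>a. P a b c d)"
  using linear2[of b c d] by (simp add: swap12[of _ b c d])

lemmas P_linear =
  linear_add[OF linear1] linear_add[OF linear2] linear_add[OF linear3] linear_add[OF linear_last]
  linear_scale[OF linear1] linear_scale[OF linear2] linear_scale[OF linear3] linear_scale[OF linear_last]
  linear_diff[OF linear1] linear_diff[OF linear2] linear_diff[OF linear3] linear_diff[OF linear_last]
  linear_0[OF linear1] linear_0[OF linear2] linear_0[OF linear3] linear_0[OF linear_last]

lemmas P_sym = swap12 swap23 swap34

lemma expand_quartic: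
  "P (s *\<^sub>R z + v) (s *\<^sub>R z + v) (s *\<^sub>R z + v) (s *\<^sub>R z + v) =
   P z z z z * s ^ 4 + 4 * P z z z v * s ^ 3 + 6 * P z z v v * s ^ 2 + 4 * P z v v v * s + P v v v v"
  by (simp add: P_linear P_sym algebra_simps power2_eq_square power3_eq_cube power4_eq_xxxx)

text \<open>
  By homogeneity \<open>p (s z + v) \<ge> 0\<close> is a polynomial condition in \<open>s\<close> in which the leading term drops out at a
  zero \<open>z\<close>. The last claim bounds the discriminant of the quadratic polynomial that remains.
\<close>

lemma at_zero:
  assumes "z \<in> zeros"
  shows "P z z z v = 0" "0 \<le> P z z v v" "2 * (P z v v v)\<^sup>2 \<le> 3 * P z z v v * P v v v v"
proof -
  have "0 \<le> 4 * P z z z v * s ^ 3 + 6 * P z z v v * s ^ 2 + 4 * P z v v v * s + P v v v v" for s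
    using nonneg[of "s *\<^sub>R z + v"] assms unfolding expand_quartic zeros_def by simp
  from nonneg_cubic_coefficients[OF this]
  show "P z z z v = 0" "0 \<le> P z z v v" "2 * (P z v v v)\<^sup>2 \<le> 3 * P z z v v * P v v v v"
    by (simp_all add: power_mult_distrib mult_ac)
qed

lemma zero_in_hessian_kernel: "z \<in> zeros \<Longrightarrow> z \<in> hessian_kernel z"
  using at_zero(1)[of z] by (simp add: hessian_kernel_def swap34[of z z _ z])

lemma subspace_hessian_kernel: "subspace (hessian_kernel z)"
  by (simp add: subspace_def hessian_kernel_def P_linear)

lemma subspace_vertex: "subspace vertex"
  by (simp add: subspace_def vertex_def P_linear)

text \<open>
  The Hessian at a minimum is positive semidefinite, so its isotropic vectors are in its kernel.
\<close>

lemma hessian_kernelI: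
  assumes z: "z \<in> zeros" and w: "P z z w w = 0"
  shows "w \<in> hessian_kernel z"
  unfolding hessian_kernel_def
proof (intro CollectI allI)
  fix v
  have "0 \<le> 0 * s ^ 3 + 0 * s ^ 2 + 2 * P z z v w * s + P z z v v" for s
    using at_zero(2)[OF z, of "s *\<^sub>R w + v"] w by (simp add: P_linear P_sym algebra_simps)
  from nonneg_cubic_coefficients(3)[OF this] show "P z z v w = 0"
    by simp
qed

lemma vertex_polarized:
  assumes a: "a \<in> vertex"
  shows "P x y v a = 0"
proof -
  have 1: "P x y y a = 0" for x y
  proof -
    have "P (x + y) (x + y) (x + y) a + P (x - y) (x - y) (x - y) a = 0" "P x x x a = 0"
      using a by (simp_all add: vertex_def)
    then show ?thesis
      by (simp add: P_linear swap12[of y x] swap23[of _ y x])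
  qed
  then have "P x (y + v) (y + v) a = 0" .
  then show ?thesis
    using 1[of x y] 1[of x v] by (simp add: P_linear swap23[of x v y])
qed

lemma vertex_subset_zeros: "vertex \<subseteq> zeros"
  by (auto simp: vertex_def zeros_def)

lemma vertex_subset_hessian_kernel: "vertex \<subseteq> hessian_kernel z"
  by (auto simp: hessian_kernel_def vertex_polarized)

text \<open>
  If the Hessian at \<open>z\<close> vanishes, the discriminant bound removes the term linear in \<open>s\<close> as well, and
  \<open>p (s z + v)\<close> does not depend on \<open>s\<close>.
\<close>

lemma vertexI:
  assumes z: "z \<in> zeros" and H: "\<And>v. P z z v v = 0"
  shows "z \<in> vertex"
proof -
  have "P z v v v = 0" for v
    using at_zero(3)[OF z, of v] H by simp
  then show ?thesis
    by (simp add: vertex_def P_sym)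
qed

text \<open>
  Let \<open>l = P z z u\<close>, so that the Hessian form is \<open>l\<^sup>2\<close>. The cubic \<open>P z v v v\<close> vanishes on the hyperplane
  \<open>l = 0\<close> by the discriminant bound, hence it equals \<open>l\<close> times a quadratic form \<open>\<beta>\<close>. The same bound then
  reads \<open>2 l\<^sup>2 \<beta>\<^sup>2 \<le> 3 l\<^sup>2 p\<close>, which makes \<open>\<beta>\<close> vanish at the zeros of \<open>p\<close>.
\<close>

lemma on_quadric_if_rank_one:
  assumes z: "z \<in> zeros" and u: "P z z u u = 1" and rank1: "\<And>v. P z z v v = (P z z u v)\<^sup>2"
  shows "on_quadric zeros"
proof -
  define l where "l = P z z u"
  define r where "r v = v - l v *\<^sub>R u" for v
  have lin_l: "linear l" unfolding l_def by (rule linear_last)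
  have lin_r: "linear r"
    by (rule linearI) (simp_all add: r_def linear_add[OF lin_l] linear_scale[OF lin_l] algebra_simps)
  \<comment> \<open>The quotient of \<open>P z v v v\<close> by \<open>l v\<close>, read off after writing \<open>v = l v u + r v\<close> and expanding.\<close>
  define \<beta> where "\<beta> v w = l v * l w * P z u u u + 3 * l v * P z u u (r w) + 3 * P z u (r v) (r w)" for v w
  have l_u: "l u = 1" and l_z: "l z = 0"
    using u at_zero(1)[OF z, of u] by (simp_all add: l_def P_sym)
  have l_r: "l (r v) = 0" for v
    by (simp add: r_def linear_diff[OF lin_l] linear_scale[OF lin_l] l_u)
  have cubic: "P z v v v = l v * \<beta> v v" for v
  proof -
    have "P z z (r v) (r v) = 0"
      by (simp add: rank1 l_r flip: l_def)
    then have 0: "P z (r v) (r v) (r v) = 0"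
      using at_zero(3)[OF z, of "r v"] by simp
    have v: "v = l v *\<^sub>R u + r v" by (simp add: r_def)
    have "P z v v v = P z (l v *\<^sub>R u + r v) (l v *\<^sub>R u + r v) (l v *\<^sub>R u + r v)"
      using v by simp
    also have "\<dots> = l v * \<beta> v v"
      using 0 by (simp add: \<beta>_def P_linear swap23[of z "r v" u] swap34[of z _ "r v" u] algebra_simps)
    finally show ?thesis .
  qed
  have "bilinear \<beta>"
    unfolding bilinear_def linear_iff \<beta>_def
    by (simp add: linear_add[OF lin_l] linear_scale[OF lin_l] linear_add[OF lin_r] linear_scale[OF lin_r]
        P_linear algebra_simps)
  moreover have "\<exists>x. \<beta> x x \<noteq> 0"
  proof (rule ccontr)
    assume "\<not> ?thesis"
    \<comment> \<open>The values of \<open>\<beta>\<close> at \<open>u\<close> and \<open>u + z\<close> differ by \<open>3 P z z u u = 3\<close>.\<close>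
    then have "\<beta> u u = 0" "\<beta> (u + z) (u + z) = 0" by auto
    moreover have "r u = 0" "r (u + z) = z" "l (u + z) = 1"
      by (simp_all add: r_def l_u l_z linear_add[OF lin_l])
    moreover have "P z u z z = 0"
      using l_z unfolding l_def by (simp add: P_sym)
    moreover have "P z u u z = 1"
      using u by (simp add: P_sym)
    ultimately show False
      by (simp add: \<beta>_def l_u P_linear)
  qed
  moreover have "\<beta> x x = 0" if x: "x \<in> zeros" for x
  proof (cases "l x = 0")
    case True
    \<comment> \<open>Here the discriminant bound says nothing; instead exchange the roles of \<open>x\<close> and \<open>z\<close>: the
      Hessian form at \<open>x\<close> vanishes at \<open>z\<close>, so \<open>z\<close> is in its kernel.\<close>
    then have "P x x z z = 0"
      using rank1[of x] by (simp add: l_def P_sym)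
    then have "z \<in> hessian_kernel x"
      by (rule hessian_kernelI[OF x])
    then have "P z u x x = 0"
      by (simp add: hessian_kernel_def P_sym)
    with True show ?thesis
      by (simp add: \<beta>_def r_def)
  next
    case False
    have "2 * (l x * \<beta> x x)\<^sup>2 \<le> 0"
      using at_zero(3)[OF z, of x] x by (simp add: cubic zeros_def)
    with False show ?thesis by simp
  qed
  ultimately show ?thesis
    unfolding on_quadric_def by blast
qed

text \<open>
  A Hessian with a kernel of codimension one is, up to a positive factor, the square of a linear form;
  codimension zero is excluded as \<open>z\<close> is not in the vertex.
\<close>

lemma dim_hessian_kernel_le:
  assumes z: "z \<in> zeros" "z \<notin> vertex" and nq: "\<not> on_quadric zeros"
  shows "dim (hessian_kernel z) + 2 \<le> DIM('a)"
proof (rule ccontr)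
  assume *: "\<not> ?thesis"
  obtain w where w: "P z z w w \<noteq> 0"
    using vertexI z by blast
  then have "0 < P z z w w"
    using at_zero(2)[OF z(1), of w] by linarith
  define u where "u = (1 / sqrt (P z z w w)) *\<^sub>R w"
  have u: "P z z u u = 1"
    using \<open>0 < P z z w w\<close> by (simp add: u_def P_linear)
  then have "u \<notin> hessian_kernel z"
    by (auto simp: hessian_kernel_def intro!: exI[of _ u])
  then have "u \<notin> span (hessian_kernel z)"
    by (simp add: span_eq_iff[THEN iffD2, OF subspace_hessian_kernel])
  then have "dim (insert u (hessian_kernel z)) = DIM('a)"
    using * dim_subset_UNIV[of "insert u (hessian_kernel z)"] by (simp add: dim_insert)
  then have full: "span (insert u (hessian_kernel z)) = UNIV"
    by (simp only: dim_eq_full)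
  have "P z z v v = (P z z u v)\<^sup>2" for v
  proof -
    have "v \<in> span (insert u (hessian_kernel z))" by (simp add: full)
    then obtain k where "v - k *\<^sub>R u \<in> span (hessian_kernel z)"
      by (auto simp: span_breakdown_eq)
    then have k: "v - k *\<^sub>R u \<in> hessian_kernel z"
      by (simp add: span_eq_iff[THEN iffD2, OF subspace_hessian_kernel])
    have "P z z u (v - k *\<^sub>R u) = 0" "P z z v (v - k *\<^sub>R u) = 0"
      using k unfolding hessian_kernel_def by auto
    then show ?thesis
      using u by (simp add: P_linear swap34[of z z v u] power2_eq_square)
  qed
  from on_quadric_if_rank_one[OF z(1) u this] nq show False by blast
qed

end

section \<open>The stabilizer of a quaternary quartic\<close>

lemma nontrivial_kernel:
  fixes f :: "'a::euclidean_space \<Rightarrow> 'b::euclidean_space"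
  assumes f: "linear f" and S: "subspace S" and ST: "f ` S \<subseteq> T" and dim: "dim T < dim S"
  obtains x where "x \<in> S" "x \<noteq> 0" "f x = 0"
proof -
  have "\<not> inj_on f S"
  proof
    assume "inj_on f S"
    then have "dim (f ` S) = dim S"
      using f S by (intro dim_image_eq) (simp_all add: span_eq_iff[THEN iffD2])
    with dim_subset[OF ST] dim show False by linarith
  qed
  then show thesis
    using that linear_inj_on_iff_eq_0[OF f S] by blast
qed

lemma linear_Pair:
  assumes "linear f" "linear g"
  shows "linear (\<lambda>x. (f x, g x))"
  using assms by (simp add: linear_iff)

locale quaternary_quartic = nonneg_quartic P
  for P :: "real^4 \<Rightarrow> real^4 \<Rightarrow> real^4 \<Rightarrow> real^4 \<Rightarrow> real"
begin

text \<open>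
  The Lie algebra of the stabilizer of \<open>p\<close>: the quartic \<open>P x x x (A *v x)\<close> is, up to the factor 4, the
  derivative of \<open>p\<close> along the linear vector field \<open>A\<close>.
\<close>

definition annihilator :: "(real^4^4) set" where
  "annihilator = {A. \<forall>x. P x x x (A *v x) = 0}"

lemma subspace_annihilator: "subspace annihilator"
  by (simp add: subspace_def annihilator_def P_linear matrix_vector_mult_add_rdistrib
      flip: scalar_matrix_assoc scaleR_matrix_vector_assoc)

text \<open>
  The flow of \<open>A\<close> preserves \<open>p\<close>, so it moves a zero \<open>z\<close> within the zero set; its velocity \<open>A *v z\<close> is a direction in
  which the gradient stays zero. In terms of \<open>P\<close>, this is the coefficient of \<open>s\<^sup>3\<close> in the defining identity
  at \<open>s z + v\<close>.
\<close>

lemma annihilator_hessian_kernel: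
  assumes A: "A \<in> annihilator" and z: "z \<in> zeros"
  shows "A *v z \<in> hessian_kernel z"
  unfolding hessian_kernel_def
proof (intro CollectI allI)
  fix v
  have "0 \<le> 3 * P z z v (A *v z) * s ^ 3 + (3 * P z z v (A *v v) + 3 * P z v v (A *v z)) * s ^ 2
      + (3 * P z v v (A *v v) + P v v v (A *v z)) * s + P v v v (A *v v)" for s
  proof -
    have "0 = P (s *\<^sub>R z + v) (s *\<^sub>R z + v) (s *\<^sub>R z + v) (A *v (s *\<^sub>R z + v))"
      using A by (simp add: annihilator_def)
    also have "\<dots> = 3 * P z z v (A *v z) * s ^ 3 + (3 * P z z v (A *v v) + 3 * P z v v (A *v z)) * s ^ 2
      + (3 * P z v v (A *v v) + P v v v (A *v z)) * s + P v v v (A *v v)"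
      using at_zero(1)[OF z]
      by (simp add: matrix_vector_right_distrib matrix_vector_mult_scaleR P_linear
          swap12[of v z] swap23[of _ v z] algebra_simps power2_eq_square power3_eq_cube)
    finally show ?thesis by simp
  qed
  from nonneg_cubic_coefficients(1)[OF this] show "P z z v (A *v z) = 0" by simp
qed

lemma annihilator_vertex:
  assumes A: "A \<in> annihilator" and a: "a \<in> vertex"
  shows "A *v a \<in> vertex"
  unfolding vertex_def
proof (intro CollectI allI)
  fix x
  have 0: "P x y a v = 0" "P x a y v = 0" "P a x y v = 0" for x y v
    using vertex_polarized[OF a, of x y v] by (simp_all add: P_sym)
  have "P (x + a) (x + a) (x + a) (A *v (x + a)) = 0" "P x x x (A *v x) = 0"
    using A by (simp_all only: annihilator_def mem_Collect_eq)
  then show "P x x x (A *v a) = 0"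
    by (simp add: matrix_vector_right_distrib P_linear 0)
qed

text \<open>
  Here \<open>A *v x = \<xi> x c\<close> for a linear form \<open>\<xi>\<close>, with \<open>c = A *v b\<close>, so \<open>\<xi> x P x x x c = 0\<close> for all \<open>x\<close>. A product of nonzero
  polynomials is not zero, and \<open>\<xi> b = 1\<close>.
\<close>

lemma annihilator_rank_one:
  assumes A: "A \<in> annihilator" and B: "independent B" "span B = UNIV" "b \<in> B"
    and kill: "\<And>x. x \<in> B - {b} \<Longrightarrow> A *v x = 0"
  shows "A *v b \<in> vertex"
  unfolding vertex_def
proof (intro CollectI allI)
  fix x
  obtain \<xi> :: "real^4 \<Rightarrow> real" where \<xi>: "linear \<xi>" "\<And>x. x \<in> B \<Longrightarrow> \<xi> x = (if x = b then 1 else 0)"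
    using linear_independent_extend[OF B(1), of "\<lambda>x. if x = b then 1 else 0"] by metis
  have A_eq: "A *v x = \<xi> x *\<^sub>R (A *v b)" for x
  proof (rule linear_eq_on_span[where B = B and f = "\<lambda>x. A *v x" and g = "\<lambda>x. \<xi> x *\<^sub>R (A *v b)"])
    show "linear (\<lambda>x. \<xi> x *\<^sub>R (A *v b))"
      by (rule linearI) (simp_all add: linear_add[OF \<xi>(1)] linear_scale[OF \<xi>(1)] algebra_simps)
  qed (use kill \<xi>(2) B in auto)
  show "P x x x (A *v b) = 0"
  proof (cases "\<xi> x = 0")
    case False
    have "P x x x (A *v x) = 0" using A by (simp add: annihilator_def)
    then show ?thesis using False by (simp add: A_eq[of x] P_linear)
  next
    case True
    \<comment> \<open>The points \<open>s x + b\<close> are off the hyperplane \<open>\<xi> = 0\<close> and tend to the direction of \<open>x\<close>; the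
      leading coefficient in \<open>s\<close> is the value at \<open>x\<close>.\<close>
    have "0 \<le> P x x x (A *v b) * s ^ 3 + 3 * P x x b (A *v b) * s ^ 2
      + 3 * P x b b (A *v b) * s + P b b b (A *v b)" for s
    proof -
      have "\<xi> (s *\<^sub>R x + b) = 1"
        using True \<xi>(2)[OF B(3)] by (simp add: linear_add[OF \<xi>(1)] linear_scale[OF \<xi>(1)])
      then have "0 = P (s *\<^sub>R x + b) (s *\<^sub>R x + b) (s *\<^sub>R x + b) (A *v b)"
        using A unfolding annihilator_def by (metis (mono_tags, lifting) A_eq mem_Collect_eq scaleR_one)
      also have "\<dots> = P x x x (A *v b) * s ^ 3 + 3 * P x x b (A *v b) * s ^ 2
      + 3 * P x b b (A *v b) * s + P b b b (A *v b)"
        by (simp add: P_linear swap12[of b x] swap23[of _ b x] algebra_simps power2_eq_square power3_eq_cube)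
      finally show ?thesis by simp
    qed
    from nonneg_cubic_coefficients(1)[OF this] show ?thesis .
  qed
qed

text \<open>
  Each \<open>A\<close> in the Lie algebra maps a zero \<open>z\<close> outside the vertex to the kernel of the Hessian, which has
  dimension at most 2, and the vertex to itself. This also bounds the dimension of the vertex by 1,
  because the kernel contains both \<open>z\<close> and the vertex. Choose a basis \<open>B\<close> of zeros that extends a basis
  \<open>V\<close> of the vertex. If the vertex is zero, killing three elements of \<open>B\<close> amounts to \<open>2 + 2 + 2\<close> conditions.
  If it is spanned by \<open>a\<close>, killing two other basis elements, \<open>a\<close>, and the \<open>a\<close>-component of the image of
  the last one amounts to \<open>2 + 2 + 1 + 1\<close> conditions.
\<close>

lemma dim_annihilator_le:
  assumes nz: "P y y y y \<noteq> 0" and nq: "\<not> on_quadric zeros"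
  shows "dim annihilator \<le> 6"
proof (rule ccontr)
  assume "\<not> ?thesis"
  then have big: "6 < dim annihilator" by simp
  have span_zeros: "span zeros = UNIV"
  proof (rule ccontr)
    assume "span zeros \<noteq> UNIV"
    then obtain a where a: "a \<noteq> 0" "\<And>x. x \<in> span zeros \<Longrightarrow> a \<bullet> x = 0"
      using span_not_UNIV_orthogonal by blast
    have "bilinear (\<lambda>v w. (a \<bullet> v) * (a \<bullet> w))"
      unfolding bilinear_def linear_iff by (simp add: algebra_simps)
    moreover have "(a \<bullet> a) * (a \<bullet> a) \<noteq> 0" using a(1) by simp
    moreover have "\<forall>z\<in>zeros. (a \<bullet> z) * (a \<bullet> z) = 0" using a(2) by (simp add: span_base)
    ultimately have "on_quadric zeros" unfolding on_quadric_def by blast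
    with nq show False ..
  qed
  have dim2: "dim (hessian_kernel z) \<le> 2" if "z \<in> zeros" "z \<notin> vertex" for z
    using dim_hessian_kernel_le[OF that nq] by simp
  have "vertex \<noteq> UNIV"
    using nz by (auto simp: vertex_def)
  then have "\<not> zeros \<subseteq> vertex"
    using span_zeros span_minimal[OF _ subspace_vertex] by blast
  then obtain z0 where z0: "z0 \<in> zeros" "z0 \<notin> vertex" by blast
  have dim1: "dim vertex \<le> 1"
  proof -
    have "dim (insert z0 vertex) \<le> dim (hessian_kernel z0)"
      using zero_in_hessian_kernel[OF z0(1)] vertex_subset_hessian_kernel by (intro dim_subset) auto
    moreover have "dim (insert z0 vertex) = dim vertex + 1"
      using z0(2) by (simp add: dim_insert span_eq_iff[THEN iffD2, OF subspace_vertex])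
    ultimately show ?thesis using dim2[OF z0] by simp
  qed
  obtain V where V: "V \<subseteq> vertex" "independent V" "vertex \<subseteq> span V" "card V = dim vertex"
    using basis_exists by blast
  obtain B where B: "V \<subseteq> B" "B \<subseteq> zeros" "independent B" "zeros \<subseteq> span B"
    using maximal_independent_subset_extend[of V zeros] V vertex_subset_zeros by blast
  have span_B: "span B = UNIV"
    using span_minimal[OF B(4) subspace_span] span_zeros by blast
  have card_B: "card B = 4" and "finite B"
    using B(3) span_B dim_eq_card[of B UNIV] independent_imp_finite[of B] by auto
  have "finite V" using B(1) \<open>finite B\<close> finite_subset by blast
  have vertexI': "\<And>b. b \<in> vertex \<Longrightarrow> b \<in> B \<Longrightarrow> b \<in> V"
  proof -
    fix b assume b: "b \<in> vertex" "b \<in> B"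
    show "b \<in> V"
    proof (rule ccontr)
      assume "b \<notin> V"
      then have "V \<subseteq> B - {b}" using B(1) by blast
      then have "b \<in> span (B - {b})" using b V(3) span_mono by blast
      then show False using B(3) b(2) by (auto simp: dependent_def)
    qed
  qed
  have eq_0: "A = 0" if "\<And>b. b \<in> B \<Longrightarrow> A *v b = 0" for A :: "real^4^4"
  proof -
    have "A *v x = 0" for x
      by (rule linear_eq_on_span[where B = B and f = "\<lambda>x. A *v x" and g = "\<lambda>x. 0"])
        (use that span_B in \<open>auto simp: linear_zero\<close>)
    then show ?thesis by (simp add: matrix_eq)
  qed
  have lin: "linear (\<lambda>A::real^4^4. A *v x)" for x
    by (rule linearI) (simp_all add: matrix_vector_mult_add_rdistrib scaleR_matrix_vector_assoc)
  show False
  proof (cases "V = {}")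
    case True
    obtain z1 z2 z3 z4 where B_eq: "B = {z1, z2, z3, z4}"
      using card_B by (auto simp: card_Suc_eq eval_nat_numeral)
    have nv: "b \<notin> vertex" if "b \<in> B" for b using vertexI'[OF _ that] True by blast
    obtain A where A: "A \<in> annihilator" "A \<noteq> 0" "(A *v z1, A *v z2, A *v z3) = 0"
    proof (rule nontrivial_kernel)
      show "linear (\<lambda>A::real^4^4. (A *v z1, A *v z2, A *v z3))"
        by (intro linear_Pair lin)
      show "(\<lambda>A::real^4^4. (A *v z1, A *v z2, A *v z3)) ` annihilator \<subseteq>
          hessian_kernel z1 \<times> hessian_kernel z2 \<times> hessian_kernel z3"
        using B(2) B_eq by (auto intro: annihilator_hessian_kernel)
      show "dim (hessian_kernel z1 \<times> hessian_kernel z2 \<times> hessian_kernel z3) < dim annihilator"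
        using big dim2[of z1] dim2[of z2] dim2[of z3] nv B(2) B_eq
        by (simp add: dim_Times subspace_hessian_kernel subspace_Times)
    qed (use subspace_annihilator in auto)
    then have kill: "A *v z1 = 0" "A *v z2 = 0" "A *v z3 = 0" by (simp_all add: zero_prod_def)
    have "A *v z4 \<in> vertex"
      by (rule annihilator_rank_one[OF A(1) B(3) span_B]) (use B_eq kill in auto)
    moreover have "A *v z4 \<noteq> 0"
      using eq_0[of A] A(2) kill B_eq by auto
    ultimately show False using V True by auto
  next
    case False
    then have "0 < card V" using \<open>finite V\<close> by (simp add: card_gt_0_iff)
    then have "card V = 1" using dim1 V(4) by linarith
    then obtain a where a: "V = {a}" by (rule card_1_singletonE)
    have "card (B - {a}) = 3" using card_B B(1) a \<open>finite B\<close> by simp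
    then obtain z1 z2 z3 where B_eq': "B - {a} = {z1, z2, z3}" and dist: "z3 \<noteq> z1" "z3 \<noteq> z2"
      by (auto simp: card_Suc_eq numeral_3_eq_3)
    then have B_eq: "B = {z1, z2, z3, a}" and ne: "z1 \<noteq> a" "z2 \<noteq> a" "z3 \<noteq> a" using B(1) a by auto
    have nv: "z1 \<notin> vertex" "z2 \<notin> vertex" "z3 \<notin> vertex"
      using vertexI' ne B_eq a by auto
    obtain \<phi> :: "real^4 \<Rightarrow> real" where \<phi>: "linear \<phi>" "\<And>x. x \<in> B \<Longrightarrow> \<phi> x = (if x = a then 1 else 0)"
      using linear_independent_extend[OF B(3), of "\<lambda>x. if x = a then 1 else 0"] by metis
    obtain A where A: "A \<in> annihilator" "A \<noteq> 0" "(A *v z1, A *v z2, \<phi> (A *v z3), A *v a) = 0"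
    proof (rule nontrivial_kernel)
      show "linear (\<lambda>A::real^4^4. (A *v z1, A *v z2, \<phi> (A *v z3), A *v a))"
        using linear_compose[OF lin \<phi>(1), of z3] by (intro linear_Pair lin) (simp add: o_def)
      show "(\<lambda>A::real^4^4. (A *v z1, A *v z2, \<phi> (A *v z3), A *v a)) ` annihilator \<subseteq>
          hessian_kernel z1 \<times> hessian_kernel z2 \<times> UNIV \<times> vertex"
        using B(2) B_eq a V(1) by (auto intro: annihilator_hessian_kernel annihilator_vertex)
      show "dim (hessian_kernel z1 \<times> hessian_kernel z2 \<times> (UNIV :: real set) \<times> vertex) < dim annihilator"
        using big dim1 dim2[of z1] dim2[of z2] nv B(2) B_eq
        by (simp add: dim_Times subspace_hessian_kernel subspace_vertex subspace_Times)
    qed (use subspace_annihilator in auto)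
    then have kill: "A *v z1 = 0" "A *v z2 = 0" "\<phi> (A *v z3) = 0" "A *v a = 0"
      by (simp_all add: zero_prod_def)
    \<comment> \<open>The kernel of the Hessian at \<open>z3\<close> is spanned by \<open>a\<close> and \<open>z3\<close>, so \<open>A\<close> has become a multiple
      of the projection onto \<open>z3\<close> along the other basis vectors.\<close>
    have ind: "independent {a, z3}" using B(3) by (rule independent_mono) (use B_eq in auto)
    have "{a, z3} \<subseteq> hessian_kernel z3"
      using a V(1) vertex_subset_hessian_kernel zero_in_hessian_kernel[of z3] B(2) B_eq by auto
    moreover have "card {a, z3} = 2" using ne by auto
    ultimately have "hessian_kernel z3 \<subseteq> span {a, z3}"
      using ind dim2[of z3] nv B(2) B_eq by (intro card_ge_dim_independent) auto
    moreover have "A *v z3 \<in> hessian_kernel z3"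
      using A(1) B(2) B_eq by (auto intro: annihilator_hessian_kernel)
    ultimately obtain m where "A *v z3 - m *\<^sub>R a \<in> span {z3}"
      using span_breakdown_eq[of "A *v z3" a "{z3}"] by blast
    then obtain l where "A *v z3 - m *\<^sub>R a = l *\<^sub>R z3"
      by (auto simp: span_singleton)
    then have lm: "A *v z3 = m *\<^sub>R a + l *\<^sub>R z3"
      by (simp add: algebra_simps)
    have "m = 0"
      using kill(3) \<phi>(2)[of a] \<phi>(2)[of z3] ne B_eq by (simp add: lm linear_add[OF \<phi>(1)] linear_scale[OF \<phi>(1)])
    have "l \<noteq> 0"
    proof
      assume "l = 0"
      then have "A = 0"
        by (intro eq_0) (use kill B_eq lm \<open>m = 0\<close> in auto)
      with A(2) show False ..
    qed
    have "A *v z3 \<in> vertex"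
      by (rule annihilator_rank_one[OF A(1) B(3) span_B]) (use B_eq kill in auto)
    then have "l *\<^sub>R z3 \<in> vertex"
      using lm \<open>m = 0\<close> by simp
    then have "(1 / l) *\<^sub>R (l *\<^sub>R z3) \<in> vertex"
      by (rule subspace_scale[OF subspace_vertex])
    with \<open>l \<noteq> 0\<close> nv show False by simp
  qed
qed

end

section \<open>Quartic forms as vectors\<close>

lemma monomial_add: "monomial (\<alpha> + \<beta>) x = monomial \<alpha> x * monomial \<beta> x"
  by (simp add: monomial_def power_add prod.distrib)

lemma monomial_axis: "monomial (axis i 1) x = x $ i"
proof -
  have "monomial (axis i 1) x = (\<Prod>j\<in>UNIV. if j = i then x $ j else 1)"
    unfolding monomial_def by (intro prod.cong) (auto simp: axis_def)
  then show ?thesis by simp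
qed

lemma axis_add_in_exponents:
  "\<beta> \<in> exponents_of_degree d \<Longrightarrow> axis i 1 + \<beta> \<in> exponents_of_degree (Suc d)"
  by (simp add: exponents_of_degree_def sum.distrib axis_def)

lemma monomial_eq_prod_list:
  assumes "\<alpha> \<in> exponents_of_degree d"
  shows "\<exists>is. length is = d \<and> (\<forall>x. monomial \<alpha> x = prod_list (map (($) x) is))"
  using assms
proof (induction d arbitrary: \<alpha>)
  case 0
  then have "monomial \<alpha> x = 1" for x
    by (simp add: exponents_of_degree_def monomial_def)
  then show ?case by simp
next
  case (Suc d)
  then have "(\<Sum>i\<in>UNIV. \<alpha> $ i) = Suc d" by (simp add: exponents_of_degree_def)
  then obtain i where i: "0 < \<alpha> $ i"
    by (metis gr0I nat.distinct(1) sum.neutral)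
  define \<beta> where "\<beta> = (\<chi> j. if j = i then \<alpha> $ j - 1 else \<alpha> $ j)"
  have \<alpha>: "\<alpha> = axis i 1 + \<beta>"
    using i by (auto simp: vec_eq_iff \<beta>_def axis_def)
  have "\<beta> \<in> exponents_of_degree d"
    using Suc.prems unfolding \<alpha> by (simp add: exponents_of_degree_def sum.distrib axis_def)
  then obtain "is" where "is": "length is = d" "\<forall>x. monomial \<beta> x = prod_list (map (($) x) is)"
    using Suc.IH by blast
  then show ?case
    by (intro exI[of _ "i # is"]) (simp add: \<alpha> monomial_add monomial_axis del: One_nat_def)
qed

text \<open>
  An exponent of degree 4 is determined by its first three entries, and there are 35 triples of
  natural numbers with sum at most 4.
\<close>

lemma card_exponents_le:
  "finite (exponents_of_degree 4 :: (nat^4) set)" "card (exponents_of_degree 4 :: (nat^4) set) \<le> 35"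
proof -
  define L :: "(nat \<times> nat \<times> nat) list" where
    "L = [(a, b, c). a \<leftarrow> [0..<5], b \<leftarrow> [0..<5 - a], c \<leftarrow> [0..<5 - a - b]]"
  define f :: "nat \<times> nat \<times> nat \<Rightarrow> nat^4" where
    "f = (\<lambda>(a, b, c). \<chi> i. if i = 1 then a else if i = 2 then b else if i = 3 then c else 4 - a - b - c)"
  have sub: "(exponents_of_degree 4 :: (nat^4) set) \<subseteq> f ` set L"
  proof
    fix \<alpha> :: "nat^4" assume "\<alpha> \<in> exponents_of_degree 4"
    then have *: "\<alpha> $ 1 + \<alpha> $ 2 + \<alpha> $ 3 + \<alpha> $ 4 = 4"
      by (simp add: exponents_of_degree_def sum_4)
    then have "\<alpha> = f (\<alpha> $ 1, \<alpha> $ 2, \<alpha> $ 3)"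
      by (auto simp: f_def vec_eq_iff forall_4)
    moreover have "(\<alpha> $ 1, \<alpha> $ 2, \<alpha> $ 3) \<in> set L"
      unfolding L_def using *
      by (simp, intro bexI[of _ "\<alpha> $ 1"] bexI[of _ "\<alpha> $ 2"]) (auto simp: image_iff)
    ultimately show "\<alpha> \<in> f ` set L" by blast
  qed
  have "length L = 35" by (simp add: L_def upt_rec)
  then have "card (f ` set L) \<le> 35"
    by (metis card_image_le card_length finite_set order_trans)
  then show "finite (exponents_of_degree 4 :: (nat^4) set)" "card (exponents_of_degree 4 :: (nat^4) set) \<le> 35"
    using sub by (auto intro: finite_subset card_mono[THEN order_trans])
qed

text \<open>
  As an index type, the exponents make quartic forms and moment vectors elements of a Euclidean space,
  in which dimensions can be counted.
\<close>

typedef quartic_exponent = "exponents_of_degree 4 :: (nat^4) set"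
proof
  show "(\<chi> i. 1) \<in> (exponents_of_degree 4 :: (nat^4) set)"
    by (simp add: exponents_of_degree_def)
qed

instance quartic_exponent :: finite
proof
  show "finite (UNIV :: quartic_exponent set)"
    using finite_imageI[OF card_exponents_le(1), of Abs_quartic_exponent]
    by (simp add: type_definition.Abs_image[OF type_definition_quartic_exponent])
qed

lemma CARD_quartic_exponent: "CARD(quartic_exponent) \<le> 35"
  using card_exponents_le(2) by (simp add: type_definition.card[OF type_definition_quartic_exponent])

definition veronese :: "real^4 \<Rightarrow> real^quartic_exponent" where
  "veronese x = (\<chi> m. monomial (Rep_quartic_exponent m) x)"

text \<open>
  Forms are identified with functions; their coefficient vectors are produced only when needed.
\<close>

definition quartic_form :: "(real^4 \<Rightarrow> real) \<Rightarrow> bool" where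
  "quartic_form f \<longleftrightarrow> (\<exists>c. \<forall>x. f x = c \<bullet> veronese x)"

lemma veronese_scaleR: "veronese (r *\<^sub>R x) = r ^ 4 *\<^sub>R veronese x"
proof -
  have "monomial (Rep_quartic_exponent m) (r *\<^sub>R x) = r ^ 4 * monomial (Rep_quartic_exponent m) x" for m
    using Rep_quartic_exponent[of m]
    by (simp add: monomial_def exponents_of_degree_def power_mult_distrib prod.distrib flip: power_sum)
  then show ?thesis by (simp add: veronese_def vec_eq_iff)
qed

lemma continuous_on_veronese: "continuous_on S veronese"
  unfolding veronese_def monomial_def by (intro continuous_intros)

lemma quartic_form_sum:
  assumes "\<And>i. i \<in> I \<Longrightarrow> quartic_form (f i)"
  shows "quartic_form (\<lambda>x. \<Sum>i\<in>I. f i x)"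
proof -
  from assms obtain c where "\<And>i x. i \<in> I \<Longrightarrow> f i x = c i \<bullet> veronese x"
    unfolding quartic_form_def by metis
  then have "(\<Sum>i\<in>I. f i x) = (\<Sum>i\<in>I. c i) \<bullet> veronese x" for x
    by (simp add: inner_sum_left)
  then show ?thesis unfolding quartic_form_def by blast
qed

lemma quartic_form_scale: "quartic_form f \<Longrightarrow> quartic_form (\<lambda>x. f x * r)"
  unfolding quartic_form_def by (metis inner_scaleR_left mult.commute)

lemma quartic_form_coordinates: "quartic_form (\<lambda>x. x $ i * x $ j * x $ k * x $ l)"
proof -
  define \<alpha> :: "nat^4" where "\<alpha> = axis i 1 + (axis j 1 + (axis k 1 + (axis l 1 + 0)))"
  have "0 \<in> (exponents_of_degree 0 :: (nat^4) set)" by (simp add: exponents_of_degree_def)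
  then have "\<alpha> \<in> exponents_of_degree (Suc (Suc (Suc (Suc 0))))"
    unfolding \<alpha>_def by (intro axis_add_in_exponents)
  then have \<alpha>: "\<alpha> \<in> exponents_of_degree 4" by (simp add: eval_nat_numeral)
  have "x $ i * x $ j * x $ k * x $ l = axis (Abs_quartic_exponent \<alpha>) 1 \<bullet> veronese x" for x :: "real^4"
    by (simp add: inner_axis' veronese_def Abs_quartic_exponent_inverse[OF \<alpha>])
      (simp add: \<alpha>_def monomial_add monomial_axis monomial_def[of 0] del: One_nat_def)
  then show ?thesis unfolding quartic_form_def by blast
qed

lemma linear_coordinates:
  fixes f :: "real^'n \<Rightarrow> real"
  assumes "linear f"
  shows "f x = (\<Sum>i\<in>UNIV. x $ i * f (axis i 1))"
proof -
  have "f x = f (\<Sum>i\<in>UNIV. x $ i *\<^sub>R axis i 1)"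
    by (simp add: basis_expansion flip: scalar_mult_eq_scaleR)
  then show ?thesis
    by (simp add: linear_sum[OF assms] linear_scale[OF assms])
qed

lemma quartic_form_quadrilinear:
  assumes "\<And>b c d. linear (\<lambda>a. T a b c d)" "\<And>a c d. linear (\<lambda>b. T a b c d)"
    "\<And>a b d. linear (\<lambda>c. T a b c d)" "\<And>a b c. linear (T a b c)"
  shows "quartic_form (\<lambda>x. T x x x x)"
proof -
  let ?e = "\<lambda>i. axis i 1 :: real^4"
  have "T x x x x = (\<Sum>i\<in>UNIV. \<Sum>j\<in>UNIV. \<Sum>k\<in>UNIV. \<Sum>l\<in>UNIV.
      (x $ i * x $ j * x $ k * x $ l) * T (?e i) (?e j) (?e k) (?e l))" for x
  proof -
    have "T x x x x = (\<Sum>i\<in>UNIV. x $ i * T (?e i) x x x)"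
      by (rule linear_coordinates) (rule assms)
    also have "\<dots> = (\<Sum>i\<in>UNIV. x $ i * (\<Sum>j\<in>UNIV. x $ j * T (?e i) (?e j) x x))"
      by (subst linear_coordinates[OF assms(2)]) (rule refl)
    also have "\<dots> = (\<Sum>i\<in>UNIV. x $ i * (\<Sum>j\<in>UNIV. x $ j * (\<Sum>k\<in>UNIV. x $ k * T (?e i) (?e j) (?e k) x)))"
      by (subst linear_coordinates[OF assms(3)]) (rule refl)
    also have "\<dots> = (\<Sum>i\<in>UNIV. x $ i * (\<Sum>j\<in>UNIV. x $ j * (\<Sum>k\<in>UNIV. x $ k *
        (\<Sum>l\<in>UNIV. x $ l * T (?e i) (?e j) (?e k) (?e l)))))"
      by (subst linear_coordinates[OF assms(4)]) (rule refl)
    finally show ?thesis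
      by (simp add: sum_distrib_left mult.assoc)
  qed
  moreover have "quartic_form (\<lambda>x. \<Sum>i\<in>UNIV. \<Sum>j\<in>UNIV. \<Sum>k\<in>UNIV. \<Sum>l\<in>UNIV.
      (x $ i * x $ j * x $ k * x $ l) * T (?e i) (?e j) (?e k) (?e l))"
    by (intro quartic_form_sum quartic_form_scale quartic_form_coordinates)
  ultimately show ?thesis by simp
qed

text \<open>
  Up to the factors 6 and 24, these are the polarizations of the monomials of degree 3 and 4 that are
  products of the coordinates with the given (possibly equal) indices.
\<close>

definition sym3 :: "'n \<Rightarrow> 'n \<Rightarrow> 'n \<Rightarrow> real^'n \<Rightarrow> real^'n \<Rightarrow> real^'n \<Rightarrow> real" where
  "sym3 i j k a b c = a $ i * (b $ j * c $ k + b $ k * c $ j) + a $ j * (b $ i * c $ k + b $ k * c $ i)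
     + a $ k * (b $ i * c $ j + b $ j * c $ i)"

definition sym4 :: "'n \<Rightarrow> 'n \<Rightarrow> 'n \<Rightarrow> 'n \<Rightarrow> real^'n \<Rightarrow> real^'n \<Rightarrow> real^'n \<Rightarrow> real^'n \<Rightarrow> real" where
  "sym4 i j k l a b c d = (a $ i * sym3 j k l b c d + a $ j * sym3 i k l b c d
     + a $ k * sym3 i j l b c d + a $ l * sym3 i j k b c d) / 24"

lemma quartic_polarization:
  obtains P where "\<And>a b c. linear (P a b c)" "\<And>a b c d. P a b c d = P b a c d"
    "\<And>a b c d. P a b c d = P a c b d" "\<And>a b c d. P a b c d = P a b d c"
    "\<And>x. P x x x x = \<gamma> \<bullet> veronese x"
proof -
  have "\<exists>i j k l. \<forall>x. monomial (Rep_quartic_exponent m) x = x $ i * x $ j * x $ k * x $ l" for m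
  proof -
    obtain "is" where "is": "length is = 4"
        "\<forall>x. monomial (Rep_quartic_exponent m) x = prod_list (map (($) x) is)"
      using monomial_eq_prod_list[OF Rep_quartic_exponent[of m]] by blast
    then obtain i j k l where "is = [i, j, k, l]"
      by (auto simp: length_Suc_conv eval_nat_numeral)
    with "is" show ?thesis by (auto simp: mult.assoc)
  qed
  then obtain i j k l where ijkl:
    "\<And>m x. monomial (Rep_quartic_exponent m) x = x $ i m * x $ j m * x $ k m * x $ l m"
    by metis
  define P where "P a b c d = (\<Sum>m\<in>UNIV. \<gamma> $ m * sym4 (i m) (j m) (k m) (l m) a b c d)" for a b c d
  show thesis
  proof
    show "linear (P a b c)" for a b c
      unfolding P_def
      by (rule linearI)
        (simp_all add: sym4_def sym3_def algebra_simps sum.distrib sum_distrib_left add_divide_distrib)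
    show "P a b c d = P b a c d" "P a b c d = P a c b d" "P a b c d = P a b d c" for a b c d
      unfolding P_def by (intro sum.cong refl; simp add: sym4_def sym3_def algebra_simps)+
    show "P x x x x = \<gamma> \<bullet> veronese x" for x
      unfolding P_def by (simp add: inner_vec_def veronese_def ijkl sym4_def sym3_def algebra_simps)
  qed
qed

section \<open>The span of the zeros of a nonnegative quartic\<close>

text \<open>
  Quadratic forms are polynomials on each line, and polynomials in one variable form an integral domain.
  On the line through \<open>x\<close> in a direction \<open>y\<close> with \<open>\<beta> y y \<noteq> 0\<close>, the leading coefficient shows that the second
  factor is not the zero polynomial.
\<close>

lemma bilinear_diag_zero_product:
  fixes \<alpha> \<beta> :: "'a::real_vector \<Rightarrow> 'a \<Rightarrow> real"
  assumes \<alpha>: "bilinear \<alpha>" and \<beta>: "bilinear \<beta>" and prod: "\<And>x. \<alpha> x x * \<beta> x x = 0" and y: "\<beta> y y \<noteq> 0"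
  shows "\<alpha> x x = 0"
proof -
  define p where "p f = [:f x x, f x y + f y x, f y y:]" for f :: "'a \<Rightarrow> 'a \<Rightarrow> real"
  have p: "poly (p f) t = f (x + t *\<^sub>R y) (x + t *\<^sub>R y)" if "bilinear f" for f t
    using that
    by (simp add: p_def bilinear_ladd bilinear_radd bilinear_lmul bilinear_rmul algebra_simps)
  have "poly (p \<alpha> * p \<beta>) t = 0" for t
    using prod by (simp add: p \<alpha> \<beta>)
  then have "p \<alpha> * p \<beta> = 0"
    using poly_all_0_iff_0 by blast
  then show ?thesis
    using y by (auto simp: p_def)
qed

text \<open>
  These are the skew matrices, which are determined by their entries above the diagonal.
\<close>

lemma dim_alternating_le: "dim {A :: real^4^4. \<forall>x. x \<bullet> (A *v x) = 0} \<le> 6"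
proof (rule ccontr)
  let ?S = "{A :: real^4^4. \<forall>x. x \<bullet> (A *v x) = 0}"
  assume "\<not> ?thesis"
  then have big: "6 < dim ?S" by simp
  define f where "f A = (A$1$2, A$1$3, A$1$4, A$2$3, A$2$4, A$3$4)" for A :: "real^4^4"
  obtain A where A: "A \<in> ?S" "A \<noteq> 0" "f A = 0"
  proof (rule nontrivial_kernel)
    show "linear f" by (rule linearI) (simp_all add: f_def)
    show "subspace ?S"
      by (simp add: subspace_def matrix_vector_mult_add_rdistrib inner_add_right
          flip: scaleR_matrix_vector_assoc)
    show "f ` ?S \<subseteq> UNIV" by simp
    show "dim (UNIV :: (real \<times> real \<times> real \<times> real \<times> real \<times> real) set) < dim ?S"
      using big by (simp add: dim_UNIV)
  qed
  have entry: "axis i 1 \<bullet> (A *v axis j 1) = A $ i $ j" for i j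
    by (simp add: inner_axis' matrix_vector_mult_basis column_def)
  have 0: "x \<bullet> (A *v x) = 0" for x using A(1) by simp
  have diag: "A $ i $ i = 0" for i
    using 0[of "axis i 1"] by (simp add: entry)
  have skew: "A $ i $ j = - A $ j $ i" for i j
    using 0[of "axis i 1 + axis j 1"]
    by (simp add: matrix_vector_right_distrib inner_add_left inner_add_right entry diag)
  have "A = 0"
    using A(3) skew[of 2 1] skew[of 3 1] skew[of 4 1] skew[of 3 2] skew[of 4 2] skew[of 4 3]
    by (simp add: f_def zero_prod_def vec_eq_iff forall_4 diag)
  with A(2) show False ..
qed

text \<open>
  A family of quartics, linear in a \<open>4 \<times> 4\<close> matrix and vanishing on \<open>Z\<close>, gives at least \<open>16 - 6 = 10\<close>
  independent coefficient vectors orthogonal to all \<open>veronese z\<close> with \<open>z \<in> Z\<close>, which leaves a span of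
  dimension at most \<open>35 - 10 = 25\<close>. Both cases of the main estimate are instances of this.
\<close>

lemma dim_veronese_le_if_vanishing:
  fixes q :: "real^4^4 \<Rightarrow> real^4 \<Rightarrow> real"
  assumes lin: "\<And>x. linear (\<lambda>A. q A x)" and form: "\<And>A. quartic_form (q A)"
    and van: "\<And>A z. z \<in> Z \<Longrightarrow> q A z = 0" and ker: "dim {A. \<forall>x. q A x = 0} \<le> 6"
  shows "dim (veronese ` Z) \<le> 25"
proof -
  obtain c where c: "\<And>A x. q A x = c A \<bullet> veronese x"
    using form unfolding quartic_form_def by metis
  define M where "M A = (\<Sum>E\<in>Basis. (A \<bullet> E) *\<^sub>R c E)" for A
  have lin_M: "linear M"
    by (rule linearI)
      (simp_all add: M_def inner_add_left scaleR_add_left sum.distrib scaleR_sum_right)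
  have M: "M A \<bullet> veronese x = q A x" for A x
  proof -
    have "q A x = q (\<Sum>E\<in>Basis. (A \<bullet> E) *\<^sub>R E) x"
      by (simp add: euclidean_representation)
    also have "\<dots> = (\<Sum>E\<in>Basis. (A \<bullet> E) * q E x)"
      by (simp add: linear_sum[OF lin] linear_scale[OF lin])
    also have "\<dots> = M A \<bullet> veronese x"
      by (simp add: M_def inner_sum_left c)
    finally show ?thesis by simp
  qed
  define N where "N = {A. \<forall>x. q A x = 0}"
  have sub_N: "subspace N"
    using lin by (simp add: N_def subspace_def linear_iff linear_0[OF lin])
  \<comment> \<open>On the orthogonal complement \<open>N'\<close> of the kernel \<open>N\<close>, of dimension at least 10, the map \<open>M\<close> is injective.\<close>
  define N' where "N' = {A \<in> UNIV. \<forall>B\<in>N. orthogonal B A}"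
  have sub_N': "subspace N'"
    using subspace_orthogonal_to_vectors[of N] by (simp add: N'_def)
  have "dim N' + dim N = dim (UNIV :: (real^4^4) set)"
    unfolding N'_def by (rule dim_subspace_orthogonal_to_vectors) (use sub_N in auto)
  then have "10 \<le> dim N'"
    using ker by (simp add: N_def dim_UNIV)
  have dim_V: "10 \<le> dim {y \<in> UNIV. \<forall>x\<in>span (veronese ` Z). orthogonal x y}" (is "10 \<le> dim ?V")
  proof (rule ccontr)
    assume "\<not> ?thesis"
    then have less: "dim ?V < dim N'" using \<open>10 \<le> dim N'\<close> by simp
    have "orthogonal x (M A)" if x: "x \<in> span (veronese ` Z)" for A x
    proof -
      have "orthogonal (M A) x"
        by (rule orthogonal_to_span[OF x]) (use van in \<open>auto simp: orthogonal_def M\<close>)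
      then show ?thesis by (simp only: orthogonal_commute)
    qed
    then have img: "M ` N' \<subseteq> ?V" by auto
    obtain A where A: "A \<in> N'" "A \<noteq> 0" "M A = 0"
      using nontrivial_kernel[OF lin_M sub_N' img less] by blast
    then have "A \<in> N" using M[of A] by (simp add: N_def)
    then have "orthogonal A A" using A(1) by (simp add: N'_def)
    with A(2) show False by (simp add: orthogonal_def)
  qed
  have "dim ?V + dim (span (veronese ` Z)) = dim (UNIV :: (real^quartic_exponent) set)"
    by (rule dim_subspace_orthogonal_to_vectors) auto
  also have "\<dots> \<le> 35" using CARD_quartic_exponent by (simp add: dim_UNIV)
  finally show ?thesis using dim_V by simp
qed

text \<open>
  The quadratic forms \<open>x \<bullet> (A *v x)\<close> are multiplied by the equation of the quadric.
\<close>

lemma dim_veronese_le_if_on_quadric: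
  assumes "on_quadric Z"
  shows "dim (veronese ` Z) \<le> 25"
proof -
  obtain \<beta> :: "real^4 \<Rightarrow> real^4 \<Rightarrow> real" and y
    where \<beta>: "bilinear \<beta>" and y: "\<beta> y y \<noteq> 0" and van: "\<And>z. z \<in> Z \<Longrightarrow> \<beta> z z = 0"
    using assms unfolding on_quadric_def by blast
  have lin: "linear (\<beta> a)" "linear (\<lambda>a. \<beta> a b)" for a b
    using \<beta> by (simp_all add: bilinear_def)
  show ?thesis
  proof (rule dim_veronese_le_if_vanishing)
    show "linear (\<lambda>A::real^4^4. (x \<bullet> (A *v x)) * \<beta> x x)" for x
      by (rule linearI) (simp_all add: matrix_vector_mult_add_rdistrib inner_add_right algebra_simps
          flip: scaleR_matrix_vector_assoc)
    show "quartic_form (\<lambda>x. (x \<bullet> (A *v x)) * \<beta> x x)" for A :: "real^4^4"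
      by (rule quartic_form_quadrilinear[where T = "\<lambda>a b c d. (a \<bullet> (A *v b)) * \<beta> c d"])
        (rule linearI; simp add: linear_add[OF lin(1)] linear_add[OF lin(2)] linear_scale[OF lin(1)]
          linear_scale[OF lin(2)] matrix_vector_right_distrib matrix_vector_mult_scaleR
          inner_add_left inner_add_right algebra_simps)+
    show "(z \<bullet> (A *v z)) * \<beta> z z = 0" if "z \<in> Z" for A :: "real^4^4" and z
      using van[OF that] by simp
    have "x \<bullet> (A *v x) = 0" if "\<And>x. (x \<bullet> (A *v x)) * \<beta> x x = 0" for A :: "real^4^4" and x
      by (rule bilinear_diag_zero_product[where \<alpha> = "\<lambda>v w. v \<bullet> (A *v w)", OF _ \<beta> that y])
        (simp add: bilinear_def linear_iff matrix_vector_right_distrib matrix_vector_mult_scaleR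
          inner_add_left inner_add_right)
    then have "{A :: real^4^4. \<forall>x. (x \<bullet> (A *v x)) * \<beta> x x = 0} \<subseteq> {A. \<forall>x. x \<bullet> (A *v x) = 0}"
      by blast
    then show "dim {A :: real^4^4. \<forall>x. (x \<bullet> (A *v x)) * \<beta> x x = 0} \<le> 6"
      using dim_alternating_le dim_subset order_trans by blast
  qed
qed

lemma dim_veronese_zeros_le:
  assumes nonneg: "\<And>x. 0 \<le> \<gamma> \<bullet> veronese x" and y: "\<gamma> \<bullet> veronese y \<noteq> 0"
  shows "dim (veronese ` {x. \<gamma> \<bullet> veronese x = 0}) \<le> 25"
proof -
  obtain P where P: "\<And>a b c. linear (P a b c)" "\<And>a b c d. P a b c d = P b a c d"
    "\<And>a b c d. P a b c d = P a c b d" "\<And>a b c d. P a b c d = P a b d c"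
    and diag: "\<And>x. P x x x x = \<gamma> \<bullet> veronese x"
    using quartic_polarization[of \<gamma>] by metis
  interpret quaternary_quartic P
    by (intro quaternary_quartic.intro nonneg_quartic.intro) (rule P | simp add: diag nonneg)+
  have zeros: "zeros = {x. \<gamma> \<bullet> veronese x = 0}"
    by (simp add: zeros_def diag)
  show ?thesis
  proof (cases "on_quadric zeros")
    case True
    then show ?thesis using dim_veronese_le_if_on_quadric zeros by metis
  next
    case False
    have linear4: "linear (\<lambda>d. P a b c (A *v d))" for a b c A
      by (rule linearI) (simp_all add: P_linear matrix_vector_right_distrib matrix_vector_mult_scaleR)
    have "dim (veronese ` zeros) \<le> 25"
    proof (rule dim_veronese_le_if_vanishing)
      show "linear (\<lambda>A. P x x x (A *v x))" for x
        by (rule linearI) (simp_all add: matrix_vector_mult_add_rdistrib P_linear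
          flip: scaleR_matrix_vector_assoc)
      show "quartic_form (\<lambda>x. P x x x (A *v x))" for A
        by (rule quartic_form_quadrilinear[where T = "\<lambda>a b c d. P a b c (A *v d)"])
          (rule linear1 linear2 linear3 linear4)+
      show "P z z z (A *v z) = 0" if "z \<in> zeros" for A z
        by (rule at_zero(1)[OF that])
      show "dim {A. \<forall>x. P x x x (A *v x) = 0} \<le> 6"
        using dim_annihilator_le[OF _ False, of y] y by (simp add: annihilator_def diag)
    qed
    then show ?thesis by (simp add: zeros)
  qed
qed

section \<open>Cones over compact sets\<close>

text \<open>
  On a hyperplane that misses the origin, the affine dimension is one less than the linear dimension,
  so Caratheodory's theorem for convex hulls needs only as many points as the linear dimension.
\<close>

lemma caratheodory_off_origin:
  fixes F :: "'a::euclidean_space set"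
  assumes base: "\<And>y. y \<in> F \<Longrightarrow> l \<bullet> y = 1" and x: "x \<in> convex hull F"
  obtains Q u where "finite Q" "Q \<subseteq> F" "card Q \<le> dim F" "\<And>y. y \<in> Q \<Longrightarrow> 0 \<le> u y" "(\<Sum>y\<in>Q. u y *\<^sub>R y) = x"
proof -
  have "affine hull F \<subseteq> {y. l \<bullet> y = 1}"
    using base by (intro hull_minimal affine_hyperplane) auto
  then have 0: "0 \<notin> affine hull F" by auto
  then have "aff_dim F + 1 = aff_dim (insert 0 F)"
    by (simp add: aff_dim_insert)
  also have "\<dots> = int (dim (insert 0 F))"
    by (rule aff_dim_zero) (simp add: hull_inc)
  finally have dim: "aff_dim F + 1 = int (dim F)"
    by (simp add: dim_insert span_zero)
  have "x \<in> {x. \<exists>Q. finite Q \<and> Q \<subseteq> F \<and> int (card Q) \<le> aff_dim F + 1 \<and> x \<in> convex hull Q}"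
    using x caratheodory_aff_dim[of F] by (simp only:)
  then obtain Q where Q: "finite Q" "Q \<subseteq> F" "int (card Q) \<le> aff_dim F + 1" "x \<in> convex hull Q"
    by blast
  then obtain u where "\<And>y. y \<in> Q \<Longrightarrow> 0 \<le> u y" "(\<Sum>y\<in>Q. u y *\<^sub>R y) = x"
    by (auto simp: convex_hull_finite)
  with Q dim that show thesis by auto
qed

text \<open>
  One generator is split off so that the rest of \<open>s\<close> lies on a proper face of the cone, where
  Caratheodory's theorem is applied in the span of the face. The supporting functional is required
  to be positive at some point of \<open>K\<close>: this holds because the remainder is outside the relative
  interior, even if \<open>K\<close> does not span the space.
\<close>

lemma conic_hull_atoms:
  fixes K :: "'a::euclidean_space set"
  assumes K: "compact K" and base: "\<And>y. y \<in> K \<Longrightarrow> l \<bullet> y = 1"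
    and faces: "\<And>a y. (\<And>y. y \<in> K \<Longrightarrow> 0 \<le> a \<bullet> y) \<Longrightarrow> y \<in> K \<Longrightarrow> 0 < a \<bullet> y \<Longrightarrow> dim {y \<in> K. a \<bullet> y = 0} \<le> N"
    and s: "s \<in> conic hull (convex hull K)"
  obtains Q d where "finite Q" "Q \<subseteq> K" "card Q \<le> N + 1" "\<And>y. y \<in> Q \<Longrightarrow> 0 < d y" "(\<Sum>y\<in>Q. d y *\<^sub>R y) = s"
proof -
  define C where "C = conic hull (convex hull K)"
  have base_hull: "l \<bullet> y = 1" if "y \<in> convex hull K" for y
  proof -
    have "convex hull K \<subseteq> {y. l \<bullet> y = 1}"
      using base by (intro hull_minimal convex_hyperplane) auto
    with that show ?thesis by auto
  qed
  have C_iff: "y \<in> C \<longleftrightarrow> (\<exists>c x. y = c *\<^sub>R x \<and> 0 \<le> c \<and> x \<in> convex hull K)" for y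
    by (auto simp: C_def conic_hull_explicit)
  have C_scale: "c *\<^sub>R y \<in> C" if "y \<in> C" "0 \<le> c" for c y
    using that conic_conic_hull unfolding C_def conic_def by blast
  have "convex C" unfolding C_def by (intro convex_conic_hull convex_convex_hull)
  have "closed C" unfolding C_def
    using base_hull[of 0] by (intro closed_conic_hull disjI2 conjI compact_convex_hull K) auto
  have l_nonneg: "0 \<le> l \<bullet> y" if "y \<in> C" for y
    using that base_hull by (auto simp: C_iff)
  have K_C: "K \<subseteq> C"
    unfolding C_def by (meson hull_subset order_trans)
  have "K \<noteq> {}" using s by auto
  then obtain y0 where y0: "y0 \<in> K" by blast
  have "0 \<in> C" using C_scale[of y0 0] K_C y0 by auto
  \<comment> \<open>All multiples of \<open>y0\<close> that can be subtracted; they are bounded since \<open>l\<close> is nonnegative on \<open>C\<close>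
    and equal to 1 at \<open>y0\<close>.\<close>
  define T where "T = {c. 0 \<le> c \<and> s - c *\<^sub>R y0 \<in> C}"
  have "0 \<in> T" using s by (simp add: T_def C_def)
  have "compact T"
  proof -
    have "T \<subseteq> {0..l \<bullet> s}"
      using l_nonneg base[OF y0] by (force simp: T_def inner_diff_right)
    moreover have "closed T"
    proof -
      have "closed ({0..} \<inter> (\<lambda>c. s - c *\<^sub>R y0) -` C)"
        by (intro closed_Int closed_vimage \<open>closed C\<close> continuous_intros closed_atLeast) 
      then show ?thesis by (simp add: T_def vimage_def Int_def)
    qed
    ultimately show ?thesis
      by (meson bounded_closed_interval bounded_subset compact_eq_bounded_closed)
  qed
  then obtain c0 where c0: "c0 \<in> T" "\<And>c. c \<in> T \<Longrightarrow> c \<le> c0"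
    using compact_attains_sup[of T] \<open>0 \<in> T\<close> by blast
  define s' where "s' = s - c0 *\<^sub>R y0"
  have s': "s' \<in> C" and "0 \<le> c0" using c0(1) by (simp_all add: T_def s'_def)
  have "s' \<notin> rel_interior C"
  proof
    assume "s' \<in> rel_interior C"
    then obtain e where e: "e > 0" "ball s' e \<inter> affine hull C \<subseteq> C"
      by (auto simp: mem_rel_interior_ball)
    have "0 < norm y0" using base[OF y0] by auto
    \<comment> \<open>In the relative interior, a little more of \<open>y0\<close> could be subtracted.\<close>
    define t where "t = e / (2 * norm y0)"
    have "0 < t" using e(1) \<open>0 < norm y0\<close> by (simp add: t_def)
    have "t * norm y0 < e"
      using e(1) \<open>0 < norm y0\<close> by (simp add: t_def)
    then have "s' - t *\<^sub>R y0 \<in> ball s' e"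
      using \<open>0 < t\<close> by (simp add: dist_norm)
    moreover have "s' - t *\<^sub>R y0 \<in> affine hull C"
    proof -
      have "affine hull C = span C" using \<open>0 \<in> C\<close> by (simp add: affine_hull_span_0 hull_inc)
      moreover have "s' \<in> span C" "y0 \<in> span C" using s' y0 K_C by (auto intro: span_base)
      ultimately show ?thesis by (simp add: span_diff span_scale)
    qed
    ultimately have "s' - t *\<^sub>R y0 \<in> C" using e(2) by blast
    then have "c0 + t \<in> T"
      using \<open>0 \<le> c0\<close> \<open>0 < t\<close> by (simp add: T_def s'_def algebra_simps)
    then show False using c0(2) \<open>0 < t\<close> by force
  qed
  then obtain a where "a \<noteq> 0" and a: "\<And>y. y \<in> C \<Longrightarrow> a \<bullet> s' \<le> a \<bullet> y"
      "\<And>y. y \<in> rel_interior C \<Longrightarrow> a \<bullet> s' < a \<bullet> y"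
    by (rule supporting_hyperplane_rel_boundary[OF \<open>convex C\<close> s']) (rule that)
  have as': "a \<bullet> s' = 0"
    using a(1)[OF \<open>0 \<in> C\<close>] a(1)[OF C_scale[OF s', of 2]] by simp
  have a_nonneg: "0 \<le> a \<bullet> y" if "y \<in> K" for y
    using a(1)[of y] as' K_C that by auto
  obtain y1 where y1: "y1 \<in> K" "0 < a \<bullet> y1"
  proof (rule ccontr)
    assume *: "\<not> thesis"
    have "rel_interior C \<noteq> {}"
      using \<open>convex C\<close> \<open>0 \<in> C\<close> by (auto simp: rel_interior_eq_empty)
    then obtain w where w: "w \<in> rel_interior C" by blast
    then obtain c x where cx: "w = c *\<^sub>R x" "0 \<le> c" "x \<in> convex hull K"
      using rel_interior_subset C_iff by blast
    have "convex hull K \<subseteq> {x. a \<bullet> x \<le> 0}"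
      using * that by (intro hull_minimal convex_halfspace_le subsetI) (metis linorder_not_le mem_Collect_eq)
    then have "a \<bullet> w \<le> 0" using cx by (auto simp: mult_nonneg_nonpos)
    with a(2)[OF w] as' show False by simp
  qed
  define F where "F = {y \<in> K. a \<bullet> y = 0}"
  have dimF: "dim F \<le> N" unfolding F_def by (rule faces[OF a_nonneg y1])
  obtain Q u where Q: "finite Q" "Q \<subseteq> K" "card Q \<le> N" "\<And>y. y \<in> Q \<Longrightarrow> 0 \<le> u y" "(\<Sum>y\<in>Q. u y *\<^sub>R y) = s'"
  proof -
    obtain c x where cx: "s' = c *\<^sub>R x" "0 \<le> c" "x \<in> convex hull K"
      using s' C_iff by blast
    show thesis
    proof (cases "c = 0")
      case True
      with that[of "{}"] cx show thesis by simp
    next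
      case False
      then have "a \<bullet> x = 0" using as' cx by simp
      have "0 \<le> a \<bullet> y" if "y \<in> convex hull K" for y
        using hull_minimal[of K "{y. 0 \<le> a \<bullet> y}" convex] convex_halfspace_ge[of 0 a] a_nonneg that by auto
      then have "(convex hull K \<inter> {y. a \<bullet> y = 0}) face_of (convex hull K)"
        by (intro face_of_Int_supporting_hyperplane_ge) auto
      then obtain S where S: "S \<subseteq> K" "convex hull K \<inter> {y. a \<bullet> y = 0} = convex hull S"
        using face_of_convex_hull_subset[OF K] by blast
      have "S \<subseteq> F" using S hull_subset[of S convex] by (auto simp: F_def)
      then have "x \<in> convex hull F"
        using S cx(3) \<open>a \<bullet> x = 0\<close> hull_mono by blast
      then obtain Q u where Q: "finite Q" "Q \<subseteq> F" "card Q \<le> dim F" "\<And>y. y \<in> Q \<Longrightarrow> 0 \<le> u y"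
        and x: "(\<Sum>y\<in>Q. u y *\<^sub>R y) = x"
        using caratheodory_off_origin[of F l x] base by (auto simp: F_def)
      have "(\<Sum>y\<in>Q. (c * u y) *\<^sub>R y) = c *\<^sub>R (\<Sum>y\<in>Q. u y *\<^sub>R y)"
        by (simp add: scaleR_sum_right)
      then show thesis
        using Q dimF cx(1,2) x by (intro that[of Q "\<lambda>y. c * u y"]) (auto simp: F_def)
    qed
  qed
  \<comment> \<open>The point \<open>y0\<close> may already occur in \<open>Q\<close> or have weight zero, so weights are added and points of
    weight zero removed.\<close>
  define d where "d y = (if y \<in> Q then u y else 0) + (if y = y0 then c0 else 0)" for y
  define R where "R = {y \<in> insert y0 Q. 0 < d y}"
  have d_nonneg: "0 \<le> d y" for y
    using Q(4) \<open>0 \<le> c0\<close> by (auto simp: d_def)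
  have "(\<Sum>y\<in>R. d y *\<^sub>R y) = (\<Sum>y\<in>insert y0 Q. d y *\<^sub>R y)"
    using Q(1) d_nonneg by (intro sum.mono_neutral_left) (auto simp: R_def less_le)
  also have "\<dots> = (\<Sum>y\<in>insert y0 Q. (if y \<in> Q then u y *\<^sub>R y else 0)) + (\<Sum>y\<in>insert y0 Q. if y = y0 then c0 *\<^sub>R y else 0)"
    unfolding sum.distrib[symmetric] by (intro sum.cong) (auto simp: d_def scaleR_add_left)
  also have "(\<Sum>y\<in>insert y0 Q. (if y \<in> Q then u y *\<^sub>R y else 0)) = (\<Sum>y\<in>Q. u y *\<^sub>R y)"
    using Q(1) by (intro sum.mono_neutral_cong_right) auto
  also have "(\<Sum>y\<in>insert y0 Q. if y = y0 then c0 *\<^sub>R y else 0) = c0 *\<^sub>R y0"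
    using Q(1) by (subst sum.delta) auto
  finally have "(\<Sum>y\<in>R. d y *\<^sub>R y) = s" by (simp add: Q(5) s'_def)
  moreover have "card R \<le> N + 1"
  proof -
    have "card R \<le> card (insert y0 Q)" using Q(1) by (intro card_mono) (auto simp: R_def)
    also have "\<dots> \<le> N + 1" using Q(3) card_insert_le_m1[of "N + 1" Q y0] by simp
    finally show ?thesis .
  qed
  ultimately show thesis
    using Q(1,2) y0 by (intro that[of R d]) (auto simp: R_def)
qed

section \<open>Measures on the projective space\<close>

text \<open>
  The discrete measure on \<open>P\<close> is transported to the Borel sets of \<open>X\<close>. Since points are closed, finite sets
  are Borel, and the compact set \<open>A \<inter> P\<close> already carries the mass of \<open>A\<close>, which gives inner regularity.
\<close>

lemma atomic_representing_measure:
  fixes X :: "'a topology" and f :: "'i \<Rightarrow> 'a \<Rightarrow> real"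
  assumes P: "finite P" "P \<subseteq> topspace X" and c: "\<And>p. p \<in> P \<Longrightarrow> 0 < c p"
    and closed: "\<And>p. p \<in> topspace X \<Longrightarrow> closedin X {p}"
    and cont: "\<And>i. i \<in> I \<Longrightarrow> continuous_map X euclideanreal (f i)"
    and s: "\<And>i. i \<in> I \<Longrightarrow> s i = (\<Sum>p\<in>P. c p * f i p)"
  shows "\<exists>M. atomic_measure X (card P) M \<and> representing_measure X I f s M"
proof -
  define N where "N = sigma (topspace X) {U. openin X U}"
  have space_N: "space N = topspace X"
    by (simp add: N_def space_measure_of_conv)
  have open_N: "U \<in> sets N" if "openin X U" for U
    using that openin_subset unfolding N_def by (auto intro: in_measure_of)
  have finite_N: "A \<in> sets N" if "finite A" "A \<subseteq> topspace X" for A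
    using that
  proof (induction A)
    case (insert p A)
    have "openin X (topspace X - {p})"
      using closed insert.prems by (simp add: closedin_def)
    then have "space N - (topspace X - {p}) \<in> sets N"
      by (intro sets.compl_sets open_N)
    moreover have "space N - (topspace X - {p}) = {p}"
      using insert.prems by (auto simp: space_N)
    ultimately show ?case
      using insert by (metis insert_is_Un insert_subset sets.Un)
  qed simp
  define D where "D = point_measure P (\<lambda>p. ennreal (c p))"
  define M where "M = distr D N (\<lambda>p. p)"
  have sets_M: "sets M = sets N" by (simp add: M_def)
  have meas: "(\<lambda>p. p) \<in> measurable D N"
    using P(2) by (auto simp: measurable_def D_def sets_point_measure space_point_measure space_N)
  have M_eq: "emeasure M A = (\<Sum>p\<in>P. ennreal (c p) * indicator A p)" if A: "A \<in> sets N" for A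
  proof -
    have "emeasure M A = emeasure D (A \<inter> P)"
      using A meas by (simp add: M_def emeasure_distr D_def space_point_measure)
    also have "\<dots> = (\<Sum>p\<in>A \<inter> P. ennreal (c p))"
      unfolding D_def using P(1) by (intro emeasure_point_measure_finite) auto
    also have "\<dots> = (\<Sum>p\<in>P. ennreal (c p) * indicator A p)"
      using P(1) by (intro sum.mono_neutral_cong_left) (auto simp: indicator_def split: if_splits)
    finally show ?thesis .
  qed
  have finite_M: "emeasure M A < \<infinity>" for A
  proof (cases "A \<in> sets N")
    case True
    then have "emeasure M A \<le> (\<Sum>p\<in>P. ennreal (c p))"
      by (simp add: M_eq) (intro sum_mono, auto simp: indicator_def)
    also have "\<dots> < \<infinity>" using P(1) by (simp add: ennreal_sum_less_top less_top[symmetric])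
    finally show ?thesis .
  qed (simp add: emeasure_notin_sets sets_M)
  have "radon_measure_on X M"
    unfolding radon_measure_on_def
  proof (intro conjI ballI allI impI)
    show "sets M = sets (sigma (topspace X) {U. openin X U})"
      by (simp add: sets_M N_def)
    show "emeasure M K < \<infinity>" for K by (rule finite_M)
  next
    fix A assume A: "A \<in> sets M"
    then have AP: "A \<inter> P \<in> sets N"
      using P by (intro finite_N) auto
    show "emeasure M A = (SUP K\<in>{K. compactin X K \<and> K \<subseteq> A}. emeasure M K)"
    proof (rule antisym)
      have "emeasure M A = emeasure M (A \<inter> P)"
        using A AP by (simp add: M_eq sets_M) (intro sum.cong, auto simp: indicator_def)
      also have "\<dots> \<le> (SUP K\<in>{K. compactin X K \<and> K \<subseteq> A}. emeasure M K)"
        using P by (intro SUP_upper CollectI conjI finite_imp_compactin) auto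
      finally show "emeasure M A \<le> \<dots>" .
      show "(SUP K\<in>{K. compactin X K \<and> K \<subseteq> A}. emeasure M K) \<le> emeasure M A"
        using A by (intro SUP_least emeasure_mono) auto
    qed
  qed
  moreover have "has_bochner_integral M (f i) (s i)" if i: "i \<in> I" for i
  proof -
    have fi: "f i \<in> borel_measurable N"
    proof (rule borel_measurableI)
      fix S :: "real set" assume "open S"
      then have "openin X {x \<in> topspace X. f i x \<in> S}"
        by (intro openin_continuous_map_preimage[OF cont[OF i]]) simp
      moreover have "{x \<in> topspace X. f i x \<in> S} = f i -` S \<inter> space N"
        by (auto simp: space_N)
      ultimately show "f i -` S \<inter> space N \<in> sets N"
        using open_N by metis
    qed
    have "integrable M (f i)"
      unfolding M_def integrable_distr_eq[OF meas fi] unfolding D_def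
      by (rule integrable_point_measure_finite[OF P(1)])
    moreover have "integral\<^sup>L M (f i) = s i"
    proof -
      have "integral\<^sup>L M (f i) = (\<Sum>p\<in>P. c p *\<^sub>R f i p)"
        unfolding M_def integral_distr[OF meas fi] unfolding D_def
        using c P(1) by (intro lebesgue_integral_point_measure_finite) (auto simp: less_imp_le)
      then show ?thesis by (simp add: s[OF i])
    qed
    ultimately show ?thesis
      by (simp add: has_bochner_integral_iff)
  qed
  moreover have "atomic_measure X (card P) M"
    unfolding atomic_measure_def
    using P c M_eq by (intro conjI exI[of _ P] exI[of _ c] ballI) (auto simp only: sets_M N_def)
  ultimately show ?thesis
    unfolding representing_measure_def by blast
qed

text \<open>
  A point of the quotient is closed because its fibre in the sphere is finite.
\<close>

lemma closedin_projective_space_singleton: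
  assumes "p \<in> proj_points"
  shows "closedin projective_space {p}"
proof -
  have "{x. x \<in> topspace (top_of_set (sphere 0 1)) \<and> proj_rep x \<in> {p}} \<subseteq> {p, - p}"
    by (auto simp: proj_rep_def split: if_splits)
  then have "finite {x. x \<in> topspace (top_of_set (sphere 0 1)) \<and> proj_rep x \<in> {p}}"
    by (rule finite_subset) simp
  then have "closedin (top_of_set (sphere 0 1)) {x. x \<in> topspace (top_of_set (sphere 0 1)) \<and> proj_rep x \<in> {p}}"
    by (intro closed_subset finite_imp_closed) auto
  then show ?thesis
    using conjunct2[OF quotient_map_proj_rep[unfolded quotient_map_closedin], rule_format, of "{p}"] assms
    by simp
qed

lemma monomial_minus:
  "\<alpha> \<in> exponents_of_degree d \<Longrightarrow> even d \<Longrightarrow> monomial \<alpha> (- x) = monomial \<alpha> x"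
proof -
  assume \<alpha>: "\<alpha> \<in> exponents_of_degree d" "even d"
  have "monomial \<alpha> (- x) = (\<Prod>i\<in>UNIV. (- 1) ^ (\<alpha> $ i)) * monomial \<alpha> x"
    unfolding monomial_def prod.distrib[symmetric]
    by (intro prod.cong) (simp_all flip: power_mult_distrib)
  also have "(\<Prod>i\<in>UNIV. (- 1 :: real) ^ (\<alpha> $ i)) = (- 1) ^ d"
    using \<alpha>(1) by (simp add: exponents_of_degree_def flip: power_sum)
  finally show "monomial \<alpha> (- x) = monomial \<alpha> x" using \<alpha>(2) by simp
qed

text \<open>
  Even degree makes the monomial invariant under \<open>x \<mapsto> - x\<close>, so that its continuity on the sphere passes to
  the quotient.
\<close>

lemma continuous_map_monomial:
  assumes "\<alpha> \<in> exponents_of_degree d" "even d"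
  shows "continuous_map projective_space euclideanreal (monomial \<alpha>)"
proof (rule continuous_compose_quotient_map[OF quotient_map_proj_rep])
  have "monomial \<alpha> (proj_rep x) = monomial \<alpha> x" for x
    using assms by (simp add: proj_rep_def monomial_minus)
  then have "monomial \<alpha> \<circ> proj_rep = monomial \<alpha>" by (simp add: fun_eq_iff)
  moreover have "continuous_on (sphere 0 1) (monomial \<alpha>)"
    unfolding monomial_def by (intro continuous_intros)
  ultimately show "continuous_map (top_of_set (sphere 0 1)) euclideanreal (monomial \<alpha> \<circ> proj_rep)"
    by simp
qed

section \<open>The moment cone of quaternary quartics\<close>

definition moment_vector :: "(nat^4 \<Rightarrow> real) \<Rightarrow> real^quartic_exponent" where
  "moment_vector s = (\<chi> m. s (Rep_quartic_exponent m))"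

definition veronese_sphere :: "(real^quartic_exponent) set" where
  "veronese_sphere = veronese ` sphere 0 1"

text \<open>
  The quartic form \<open>(x \<bullet> x)\<^sup>2\<close> is 1 on the sphere.
\<close>

lemma veronese_sphere_base:
  obtains l where "\<And>y. y \<in> veronese_sphere \<Longrightarrow> l \<bullet> y = 1"
proof -
  have "quartic_form (\<lambda>x. (x \<bullet> x) * (x \<bullet> x))"
    by (rule quartic_form_quadrilinear[where T = "\<lambda>a b c d. (a \<bullet> b) * (c \<bullet> d)"])
      (rule linearI; simp add: inner_add_left inner_add_right algebra_simps)+
  then obtain l where l: "\<And>x. (x \<bullet> x) * (x \<bullet> x) = l \<bullet> veronese x"
    unfolding quartic_form_def by blast
  have "l \<bullet> y = 1" if "y \<in> veronese_sphere" for y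
    using that by (auto simp: veronese_sphere_def dot_square_norm simp flip: l)
  then show thesis by (rule that)
qed

lemma compact_veronese_sphere: "compact veronese_sphere"
  unfolding veronese_sphere_def
  by (intro compact_continuous_image continuous_on_veronese compact_sphere)

text \<open>
  A functional that separates the moment vector from the closed cone is a quartic form that is nonnegative
  on the sphere but has a negative integral.
\<close>

lemma moment_vector_in_cone:
  assumes "moment_sequence projective_space (exponents_of_degree 4) monomial s"
  shows "moment_vector s \<in> conic hull (convex hull veronese_sphere)"
proof (rule ccontr)
  let ?C = "conic hull (convex hull veronese_sphere)"
  assume notin: "moment_vector s \<notin> ?C"
  obtain M where M: "representing_measure projective_space (exponents_of_degree 4) monomial s M"
    using assms unfolding moment_sequence_def by blast
  obtain l where l: "\<And>y. y \<in> veronese_sphere \<Longrightarrow> l \<bullet> y = 1"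
    using veronese_sphere_base by blast
  have "convex hull veronese_sphere \<subseteq> {y. l \<bullet> y = 1}"
    using l by (intro hull_minimal convex_hyperplane) auto
  then have "0 \<notin> convex hull veronese_sphere" by auto
  then have "closed ?C"
    by (intro closed_conic_hull disjI2 conjI compact_convex_hull compact_veronese_sphere)
  moreover have "convex ?C" by (intro convex_conic_hull convex_convex_hull)
  ultimately obtain a b where ab: "a \<bullet> moment_vector s < b" "\<And>y. y \<in> ?C \<Longrightarrow> b < a \<bullet> y"
    using separating_hyperplane_closed_point[of ?C "moment_vector s"] notin by blast
  have scale: "c *\<^sub>R y \<in> ?C" if "y \<in> ?C" "0 \<le> c" for c y
    using that conic_conic_hull unfolding conic_def by blast
  have veronese_in: "veronese x \<in> ?C" if "x \<in> sphere 0 1" for x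
    using that unfolding veronese_sphere_def by (intro hull_inc) auto
  have "0 *\<^sub>R veronese (axis 1 1) \<in> ?C"
    by (intro scale veronese_in) simp_all
  then have "0 \<in> ?C" by simp
  then have "b < 0" using ab(2)[of 0] by simp
  have a_nonneg: "0 \<le> a \<bullet> veronese x" if x: "x \<in> sphere 0 1" for x
  proof (rule ccontr)
    assume *: "\<not> ?thesis"
    then have "b < a \<bullet> ((b / (a \<bullet> veronese x)) *\<^sub>R veronese x)"
      using \<open>b < 0\<close> by (intro ab(2) scale veronese_in x) (simp add: divide_nonpos_neg)
    with * show False by simp
  qed
  have "has_bochner_integral M (\<lambda>x. \<Sum>m\<in>UNIV. a $ m * monomial (Rep_quartic_exponent m) x)
      (\<Sum>m\<in>UNIV. a $ m * s (Rep_quartic_exponent m))"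
    using M Rep_quartic_exponent unfolding representing_measure_def
    by (intro has_bochner_integral_sum has_bochner_integral_mult_right) blast
  then have int: "has_bochner_integral M (\<lambda>x. a \<bullet> veronese x) (a \<bullet> moment_vector s)"
    by (simp add: inner_vec_def veronese_def moment_vector_def)
  have "space M = proj_points"
    using M sets_eq_imp_space_eq[of M "sigma (topspace projective_space) {U. openin projective_space U}"]
    by (simp add: representing_measure_def radon_measure_on_def space_measure_of_conv)
  then have "0 \<le> integral\<^sup>L M (\<lambda>x. a \<bullet> veronese x)"
    using a_nonneg by (intro integral_nonneg_AE AE_I2) (simp add: proj_points_def)
  then show False
    using int ab(1) \<open>b < 0\<close> by (simp add: has_bochner_integral_integral_eq)
qed

lemma dim_face_veronese_sphere_le:
  assumes nonneg: "\<And>y. y \<in> veronese_sphere \<Longrightarrow> 0 \<le> a \<bullet> y"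
    and y: "y \<in> veronese_sphere" "0 < a \<bullet> y"
  shows "dim {y \<in> veronese_sphere. a \<bullet> y = 0} \<le> 25"
proof -
  have "0 \<le> a \<bullet> veronese x" for x
  proof (cases "x = 0")
    case True
    then show ?thesis using veronese_scaleR[of 0 x] by simp
  next
    case False
    then have "veronese (x /\<^sub>R norm x) \<in> veronese_sphere"
      by (simp add: veronese_sphere_def)
    then have "0 \<le> norm x ^ 4 * (a \<bullet> veronese (x /\<^sub>R norm x))"
      using nonneg by simp
    also have "\<dots> = a \<bullet> veronese (norm x *\<^sub>R (x /\<^sub>R norm x))"
      by (simp only: veronese_scaleR inner_scaleR_right)
    finally show ?thesis using False by simp
  qed
  moreover obtain x where "a \<bullet> veronese x \<noteq> 0"
    using y unfolding veronese_sphere_def by force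
  ultimately have "dim (veronese ` {x. a \<bullet> veronese x = 0}) \<le> 25"
    by (rule dim_veronese_zeros_le)
  moreover have "{y \<in> veronese_sphere. a \<bullet> y = 0} \<subseteq> veronese ` {x. a \<bullet> veronese x = 0}"
    by (auto simp: veronese_sphere_def)
  ultimately show ?thesis
    using dim_subset order_trans by blast
qed

theorem theorem59:
  shows "caratheodory_number (projective_space :: (real ^ 4) topology)
           (exponents_of_degree 4) monomial \<le> 26"
proof -
  have "\<exists>k\<le>26. \<exists>M. atomic_measure projective_space k M \<and>
      representing_measure projective_space (exponents_of_degree 4) monomial s M"
    if s: "moment_sequence (projective_space :: (real ^ 4) topology) (exponents_of_degree 4) monomial s" for s
  proof -
    obtain l where l: "\<And>y. y \<in> veronese_sphere \<Longrightarrow> l \<bullet> y = 1"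
      using veronese_sphere_base by blast
    obtain Q d where Q: "finite Q" "Q \<subseteq> veronese_sphere" "card Q \<le> 25 + 1"
      and d: "\<And>y. y \<in> Q \<Longrightarrow> 0 < d y" and sum: "(\<Sum>y\<in>Q. d y *\<^sub>R y) = moment_vector s"
    proof (rule conic_hull_atoms[where K = veronese_sphere and l = l and N = 25 and s = "moment_vector s"])
      show "dim {y \<in> veronese_sphere. a \<bullet> y = 0} \<le> 25"
        if "\<And>y. y \<in> veronese_sphere \<Longrightarrow> 0 \<le> a \<bullet> y" "y \<in> veronese_sphere" "0 < a \<bullet> y" for a y
        by (rule dim_face_veronese_sphere_le[OF that])
    qed (use compact_veronese_sphere l moment_vector_in_cone[OF s] that in blast)+
    have "\<exists>p\<in>proj_points. veronese p = y" if y: "y \<in> Q" for y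
    proof -
      obtain x where x: "x \<in> sphere 0 1" "y = veronese x"
        using y Q(2) unfolding veronese_sphere_def by blast
      have "veronese (proj_rep x) = veronese x"
        using veronese_scaleR[of "- 1" x] by (simp add: proj_rep_def)
      with x proj_rep_in[OF x(1)] show ?thesis by auto
    qed
    then obtain g where g: "\<And>y. y \<in> Q \<Longrightarrow> g y \<in> proj_points" "\<And>y. y \<in> Q \<Longrightarrow> veronese (g y) = y"
      by metis
    have inj: "inj_on g Q" by (rule inj_on_inverseI[of _ veronese]) (rule g(2))
    have s_eq: "s \<alpha> = (\<Sum>p\<in>g ` Q. d (veronese p) * monomial \<alpha> p)" if \<alpha>: "\<alpha> \<in> exponents_of_degree 4" for \<alpha>
    proof -
      let ?m = "Abs_quartic_exponent \<alpha>"
      have "s \<alpha> = moment_vector s $ ?m"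
        by (simp add: moment_vector_def Abs_quartic_exponent_inverse[OF \<alpha>])
      also have "\<dots> = (\<Sum>y\<in>Q. d y * y $ ?m)"
        by (simp flip: sum)
      also have "\<dots> = (\<Sum>y\<in>Q. d (veronese (g y)) * monomial \<alpha> (g y))"
      proof (intro sum.cong refl)
        fix y assume y: "y \<in> Q"
        have "monomial \<alpha> (g y) = veronese (g y) $ ?m"
          by (simp add: veronese_def Abs_quartic_exponent_inverse[OF \<alpha>])
        then show "d y * y $ ?m = d (veronese (g y)) * monomial \<alpha> (g y)"
          by (simp add: g(2)[OF y])
      qed
      also have "\<dots> = (\<Sum>p\<in>g ` Q. d (veronese p) * monomial \<alpha> p)"
        by (simp add: sum.reindex[OF inj])
      finally show ?thesis .
    qed
    have "\<exists>M. atomic_measure projective_space (card (g ` Q)) M \<and>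
        representing_measure projective_space (exponents_of_degree 4) monomial s M"
    proof (rule atomic_representing_measure)
      show "continuous_map projective_space euclideanreal (monomial \<alpha>)"
        if "\<alpha> \<in> exponents_of_degree 4" for \<alpha> :: "nat^4"
        using that by (rule continuous_map_monomial) simp
    qed (use Q(1) g d s_eq in \<open>auto simp: closedin_projective_space_singleton\<close>)
    moreover have "card (g ` Q) \<le> 26"
      using Q(3) by (simp add: card_image[OF inj])
    ultimately show ?thesis by blast
  qed
  then have "caratheodory_number (projective_space :: (real ^ 4) topology)
      (exponents_of_degree 4) monomial \<le> enat 26"
    unfolding caratheodory_number_def by (intro Inf_lower CollectI exI[of _ 26]) blast
  then show ?thesis by (simp add: numeral_eq_enat)
qed

end
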